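(* Let $T=(T_\omega)_{\omega\in\Omega}$ be a continuous bundle random dynamical system on a compact metric space $(X,d)$ over $(\Omega,\mathcal{F},\mathbf{P},\vartheta)$, and let $\mu\in M^1_{\mathbf{P}}(\Omega\times X,T)$. Then for $\mu$-a.e. $(\omega,x)\in\Omega\times X$, $$h^{(r)}_\mu(T,\omega,x)=\lim_{\delta\to0}\liminf_{n\to\infty}-\frac1n\log\mu_\omega(B_{FK_n}(\omega,x,\delta))=\lim_{\delta\to0}\limsup_{n\to\infty}-\frac1n\log\mu_\omega(B_{FK_n}(\omega,x,\delta)).$$
   Context: Setting. $(\Omega,\mathcal{F},\mathbf{P})$ is a probability space with $\mathcal{F}$ complete, countably generated and separating points (so it is a Lebesgue space), and $\vartheta:\Omega\to\Omega$ is an invertible ergodic $\mathbf{P}$-preserving transformation. $(X,d)$ is a compact metric space with Borel $\sigma$-algebra $\mathcal{B}$. A continuous bundle random dynamical system (RDS) $T=(T_\omega)_\omega$ over $(\Omega,\mathcal{F},\mathbf{P},\vartheta)$ is a family of maps $T_\omega:X\to X$ such that $(\omega,x)\mapsto T_\omega(x)$ is measurable with respect to $\mathcal{F}\times\mathcal{B}$ and $x\mapsto T_\omega(x)$ is continuous for $\mathbf{P}$-a.e. $\omega$. Iterates: $T^0_\omega=\mathrm{id}$ and $T^n_\omega=T_{\vartheta^{n-1}\omega}\circ\cdots\circ T_{\vartheta\omega}\circ T_\omega$ for $n\ge 1$. The skew product is $\Theta(\omega,x)=(\vartheta\omega,T_\omega x)$ on $\Omega\times X$. Measures. $M^1_{\mathbf{P}}(\Omega\times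 X,T)$ is the set of probability measures on $(\Omega\times X,\mathcal{F}\times\mathcal{B})$ that are $\Theta$-invariant and have marginal $\mathbf{P}$ on $\Omega$. Such $\mu$ is disintegrated as $d\mu(\omega,x)=d\mu_\omega(x)\,d\mathbf{P}(\omega)$. Bowen metric. $d^n_\omega(x,y)=\max_{0\le i\le n-1}d(T^i_\omega(x),T^i_\omega(y))$ and $B_n(\omega,x,\delta)=\{y\in X:d^n_\omega(x,y)<\delta\}$. Feldman-Katok (FK) metric. For $n\in\mathbb{N}$, $\varepsilon>0$, $x,y\in X$, an $(\omega,n,\varepsilon)$-match of $x$ and $y$ is an order preserving bijection $\pi:D(\pi)\to R(\pi)$ (i.e. $\pi(i)<\pi(j)$ whenever $i<j$) with $D(\pi),R(\pi)\subset\{0,1,\dots,n-1\}$ such that $d(T^i_\omega(x),T^{\pi(i)}_\omega(y))<\varepsilon$ for every $i\in D(\pi)$ (the empty match is allowed). Let $|\pi|$ be the cardinality of $D(\pi)$, and put $$\bar f_{\omega,n,\varepsilon}(x,y)=1-\tfrac1n\max\{|\pi|:\pi\text{ is an }(\omega,n,\varepsilon)\text{-match of }x\text{ and }y\},$$ $$d^{FK_n}_\omega(x,y)=\inf\{\varepsilon>0:\bar f_{\omega,n,\varepsilon}(x,y)<\varepsilon\},\qquad B_{FK_n}(\omega,x,\delta)=\{y\in X:d^{FK_n}_\omega(x,y)<\delta\}.$$ Local entropy. The local entropy at $(\omega,x)$ with respect to $\mu$ is $$h^{(r)}_\mu(T,\omega,x)=\lim_{\delta\to0}\liminf_{n\to\infty}-\tfrac1n\log\mu_\omega(B_n(\omega,x,\delta))=\lim_{\delta\to0}\limsup_{n\to\infty}-\tfrac1n\log\mu_\omega(B_n(\omega,x,\delta))\in[0,\infty],$$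 the two limits being known to coincide for $\mu$-a.e. $(\omega,x)$ (random Brin-Katok formula of Zhu). *)

theory Defs
  imports "HOL-Probability.Probability"
begin

text \<open>
  A complete \<open>\<sigma>\<close>-algebra containing a null set of cardinality continuum is never generated by
  countably many sets in the literal sense. As usual for Lebesgue spaces, ``countably generated''
  is therefore meant up to completion; the literal notion is the special case where the completion
  adds nothing. The same countable family is required to separate points.
\<close>

definition countably_generated_separating :: "'w measure \<Rightarrow> bool" where
  "countably_generated_separating P \<longleftrightarrow>
     (\<exists>A. countable A \<and> A \<subseteq> sets P \<and>
        sets P = sets (completion (restr_to_subalg P (sigma (space P) A))) \<and>
        (\<forall>\<omega>\<in>space P. \<forall>\<omega>'\<in>space P. \<omega> \<noteq> \<omega>' \<longrightarrow> (\<exists>a\<in>A. (\<omega> \<in> a) \<noteq> (\<omega>' \<in> a))))"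

locale ergodic_base = prob_space P + complete_measure P
  for P :: "'w measure" +
  fixes \<theta> :: "'w \<Rightarrow> 'w"
  assumes countably_generated_separating: "countably_generated_separating P"
    and bij_\<theta>: "bij_betw \<theta> (space P) (space P)"
    and measurable_\<theta>: "\<theta> \<in> measurable P P"
    and measurable_inv_\<theta>: "inv_into (space P) \<theta> \<in> measurable P P"
    and preserving_\<theta>: "distr P P \<theta> = P"
    and ergodic_\<theta>: "\<And>A. A \<in> sets P \<Longrightarrow> \<theta> -` A \<inter> space P = A \<Longrightarrow> measure P A = 0 \<or> measure P A = 1"

locale continuous_bundle_rds = ergodic_base P \<theta>
  for P :: "'w measure" and \<theta> :: "'w \<Rightarrow> 'w" +
  fixes T :: "'w \<Rightarrow> 'x \<Rightarrow> 'x :: metric_space"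
  assumes measurable_T: "(\<lambda>(\<omega>, x). T \<omega> x) \<in> measurable (P \<Otimes>\<^sub>M borel) borel"
    and continuous_T: "AE \<omega> in P. continuous_on UNIV (T \<omega>)"

primrec rds_iter :: "('w \<Rightarrow> 'w) \<Rightarrow> ('w \<Rightarrow> 'x \<Rightarrow> 'x) \<Rightarrow> nat \<Rightarrow> 'w \<Rightarrow> 'x \<Rightarrow> 'x" where
  "rds_iter \<theta> T 0 \<omega> = id"
| "rds_iter \<theta> T (Suc n) \<omega> = T ((\<theta> ^^ n) \<omega>) \<circ> rds_iter \<theta> T n \<omega>"

definition skew_product :: "('w \<Rightarrow> 'w) \<Rightarrow> ('w \<Rightarrow> 'x \<Rightarrow> 'x) \<Rightarrow> 'w \<times> 'x \<Rightarrow> 'w \<times> 'x" where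
  "skew_product \<theta> T = (\<lambda>(\<omega>, x). (\<theta> \<omega>, T \<omega> x))"

definition invariant_measures ::
  "'w measure \<Rightarrow> ('w \<Rightarrow> 'w) \<Rightarrow> ('w \<Rightarrow> 'x \<Rightarrow> 'x :: topological_space) \<Rightarrow> ('w \<times> 'x) measure set" where
  "invariant_measures P \<theta> T =
     {\<mu>. prob_space \<mu> \<and> sets \<mu> = sets (P \<Otimes>\<^sub>M borel) \<and>
         distr \<mu> \<mu> (skew_product \<theta> T) = \<mu> \<and> distr \<mu> P fst = P}"

definition is_disintegration ::
  "'w measure \<Rightarrow> ('w \<times> 'x :: topological_space) measure \<Rightarrow> ('w \<Rightarrow> 'x measure) \<Rightarrow> bool" where
  "is_disintegration P \<mu> \<kappa> \<longleftrightarrow>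
     \<kappa> \<in> measurable P (prob_algebra borel) \<and>
     (\<forall>A\<in>sets (P \<Otimes>\<^sub>M borel). emeasure \<mu> A = (\<integral>\<^sup>+\<omega>. emeasure (\<kappa> \<omega>) {x. (\<omega>, x) \<in> A} \<partial>P))"

text \<open>The metrics below are used for \<open>n \<ge> 1\<close> only; their values at \<open>n = 0\<close> are irrelevant.\<close>

definition bowen_dist ::
  "('w \<Rightarrow> 'w) \<Rightarrow> ('w \<Rightarrow> 'x \<Rightarrow> 'x :: metric_space) \<Rightarrow> nat \<Rightarrow> 'w \<Rightarrow> 'x \<Rightarrow> 'x \<Rightarrow> real" where
  "bowen_dist \<theta> T n \<omega> x y = (MAX i\<in>{..<n}. dist (rds_iter \<theta> T i \<omega> x) (rds_iter \<theta> T i \<omega> y))"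

definition bowen_ball ::
  "('w \<Rightarrow> 'w) \<Rightarrow> ('w \<Rightarrow> 'x \<Rightarrow> 'x :: metric_space) \<Rightarrow> nat \<Rightarrow> 'w \<Rightarrow> 'x \<Rightarrow> real \<Rightarrow> 'x set" where
  "bowen_ball \<theta> T n \<omega> x \<delta> = {y. bowen_dist \<theta> T n \<omega> x y < \<delta>}"

text \<open>A match is given by its domain \<open>D\<close> and the map \<open>\<pi>\<close> on it; its range is the image of \<open>D\<close>.\<close>

definition is_match ::
  "('w \<Rightarrow> 'w) \<Rightarrow> ('w \<Rightarrow> 'x \<Rightarrow> 'x :: metric_space) \<Rightarrow> 'w \<Rightarrow> nat \<Rightarrow> real \<Rightarrow> 'x \<Rightarrow> 'x \<Rightarrow>
    nat set \<Rightarrow> (nat \<Rightarrow> nat) \<Rightarrow> bool" where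
  "is_match \<theta> T \<omega> n \<epsilon> x y D \<pi> \<longleftrightarrow>
     D \<subseteq> {..<n} \<and> \<pi> ` D \<subseteq> {..<n} \<and> strict_mono_on D \<pi> \<and>
     (\<forall>i\<in>D. dist (rds_iter \<theta> T i \<omega> x) (rds_iter \<theta> T (\<pi> i) \<omega> y) < \<epsilon>)"

definition fbar ::
  "('w \<Rightarrow> 'w) \<Rightarrow> ('w \<Rightarrow> 'x \<Rightarrow> 'x :: metric_space) \<Rightarrow> 'w \<Rightarrow> nat \<Rightarrow> real \<Rightarrow> 'x \<Rightarrow> 'x \<Rightarrow> real" where
  "fbar \<theta> T \<omega> n \<epsilon> x y = 1 - real (Max {card D |D \<pi>. is_match \<theta> T \<omega> n \<epsilon> x y D \<pi>}) / real n"

definition fk_dist ::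
  "('w \<Rightarrow> 'w) \<Rightarrow> ('w \<Rightarrow> 'x \<Rightarrow> 'x :: metric_space) \<Rightarrow> nat \<Rightarrow> 'w \<Rightarrow> 'x \<Rightarrow> 'x \<Rightarrow> real" where
  "fk_dist \<theta> T n \<omega> x y = Inf {\<epsilon>. \<epsilon> > 0 \<and> fbar \<theta> T \<omega> n \<epsilon> x y < \<epsilon>}"

definition fk_ball ::
  "('w \<Rightarrow> 'w) \<Rightarrow> ('w \<Rightarrow> 'x \<Rightarrow> 'x :: metric_space) \<Rightarrow> nat \<Rightarrow> 'w \<Rightarrow> 'x \<Rightarrow> real \<Rightarrow> 'x set" where
  "fk_ball \<theta> T n \<omega> x \<delta> = {y. fk_dist \<theta> T n \<omega> x y < \<delta>}"

text \<open>
  \<open>- (1/n) log \<nu>(B)\<close> with the convention \<open>log 0 = - \<infinity>\<close>; the case distinction is needed because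
  \<open>ln 0 = 0\<close> in the library.
\<close>

definition decay_rate :: "'x measure \<Rightarrow> nat \<Rightarrow> 'x set \<Rightarrow> ereal" where
  "decay_rate \<nu> n B = (if measure \<nu> B = 0 then \<infinity> else ereal (- (1 / real n) * ln (measure \<nu> B)))"

text \<open>
  The local entropy is defined only at points where both double limits exist and agree, hence it
  is a (single-valued) relation.
\<close>

definition has_local_entropy ::
  "('w \<Rightarrow> 'w) \<Rightarrow> ('w \<Rightarrow> 'x \<Rightarrow> 'x :: metric_space) \<Rightarrow> ('w \<Rightarrow> 'x measure) \<Rightarrow> 'w \<Rightarrow> 'x \<Rightarrow> ereal \<Rightarrow> bool" where
  "has_local_entropy \<theta> T \<kappa> \<omega> x h \<longleftrightarrow>
     ((\<lambda>\<delta>. liminf (\<lambda>n. decay_rate (\<kappa> \<omega>) n (bowen_ball \<theta> T n \<omega> x \<delta>))) \<longlongrightarrow> h) (at_right 0) \<and>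
     ((\<lambda>\<delta>. limsup (\<lambda>n. decay_rate (\<kappa> \<omega>) n (bowen_ball \<theta> T n \<omega> x \<delta>))) \<longlongrightarrow> h) (at_right 0)"

end

theory Submission
  imports Defs
begin

text \<open>
  The argument avoids entropy theory altogether. Bowen balls lie in FK balls, so it suffices to show
  that almost surely the upper decay rate of Bowen balls is at most the lower decay rate of FK balls.
  Suppose that the latter is below \<open>c\<close>. Then for infinitely many \<open>n\<close> the FK ball has measure at least
  \<open>exp (- c n)\<close>, and in each fibre the set of such points is covered by about \<open>exp (c n)\<close> FK balls. For
  small radius an FK ball is covered by subexponentially many sets of small Bowen diameter, since a
  point is determined up to \<open>\<eta>\<close> by the unmatched times and its approximate position there. The
  property is inherited along orbits, so by the maximal ergodic inequality most of \<open>[0, N)\<close>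
  can be tiled by intervals on which the orbit segment lies in one of these few sets; hence about
  \<open>exp (c N)\<close> sets of small Bowen diameter suffice at every scale \<open>N\<close>. By Borel--Cantelli,
  a point almost surely cannot have Bowen balls of measure much below \<open>exp (- c N)\<close> infinitely often.
\<close>

section \<open>Matches and Feldman--Katok balls\<close>

text \<open>The times at which a point has a heavy FK ball depend on the point and are unbounded, so
  no single scale serves a whole fibre. Tiles are therefore truncated at length M, and times at
  which no tile of length at most M can start become holes. Each hole costs a constant factor, which
  is affordable only if holes are rare. The points of low FK rate without a tile of length at most M
  decrease to the empty set, and the maximal inequality turns this into a bound on hole frequencies
  that is uniform in N. The counting holds in every fibre with constants independent of \<omega>,
  because disjoint balls are packed into the probability measure \<open>\<kappa> \<omega>\<close>
  itself. The low rate is demanded at all tolerances at once, and with slack in the exponent,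
  because a shift along the orbit doubles the tolerance and shortens the match. Finally the
  inequality closes a cycle: FK lower rate \<le> Bowen lower rate \<le> Bowen upper rate \<le> FK
  lower rate. Existence of the local entropy thus comes out together with its
  identification.\<close>

definition match_ball ::
  "('w \<Rightarrow> 'w) \<Rightarrow> ('w \<Rightarrow> 'x \<Rightarrow> 'x :: metric_space) \<Rightarrow> nat \<Rightarrow> 'w \<Rightarrow> 'x \<Rightarrow> real \<Rightarrow> 'x set" where
  "match_ball \<theta> T n \<omega> x \<epsilon> =
     {y. \<exists>D \<pi>. is_match \<theta> T \<omega> n \<epsilon> x y D \<pi> \<and> (1 - \<epsilon>) * real n < real (card D)}"

lemma rds_iter_add:
  "rds_iter \<theta> T (n + m) \<omega> x = rds_iter \<theta> T m ((\<theta> ^^ n) \<omega>) (rds_iter \<theta> T n \<omega> x)"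
  by (induction m) (simp_all add: funpow_add add.commute flip: funpow_add comp_apply[of "\<theta> ^^ _"])

lemma skew_product_funpow:
  "(skew_product \<theta> T ^^ n) (\<omega>, x) = ((\<theta> ^^ n) \<omega>, rds_iter \<theta> T n \<omega> x)"
  by (induction n) (auto simp: skew_product_def)

lemma finite_match_cards: "finite {card D |D \<pi>. is_match \<theta> T \<omega> n \<epsilon> x y D \<pi>}"
proof (rule finite_subset)
  show "{card D |D \<pi>. is_match \<theta> T \<omega> n \<epsilon> x y D \<pi>} \<subseteq> card ` Pow {..<n}"
    by (auto simp: is_match_def)
qed auto

lemma match_cards_nonempty: "{card D |D \<pi>. is_match \<theta> T \<omega> n \<epsilon> x y D \<pi>} \<noteq> {}"
proof -
  have "is_match \<theta> T \<omega> n \<epsilon> x y {} id" by (auto simp: is_match_def)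
  then show ?thesis by blast
qed

text \<open>The maximum over a finite nonempty set is large iff one member is. In
  \<open>match_ball\<close> a single \<epsilon> bounds both the distances and the fraction of
  unmatched times, so one witnessing match suffices.\<close>

lemma fbar_less_iff:
  assumes "n > 0"
  shows "fbar \<theta> T \<omega> n \<epsilon> x y < \<epsilon> \<longleftrightarrow> y \<in> match_ball \<theta> T n \<omega> x \<epsilon>"
proof -
  let ?S = "{card D |D \<pi>. is_match \<theta> T \<omega> n \<epsilon> x y D \<pi>}"
  have "fbar \<theta> T \<omega> n \<epsilon> x y < \<epsilon> \<longleftrightarrow> (1 - \<epsilon>) * real n < real (Max ?S)"
    using assms by (simp add: fbar_def field_simps)
  also have "\<dots> \<longleftrightarrow> (\<exists>k\<in>?S. (1 - \<epsilon>) * real n < real k)"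
  proof
    assume "(1 - \<epsilon>) * real n < real (Max ?S)"
    moreover have "Max ?S \<in> ?S" by (intro Max_in finite_match_cards match_cards_nonempty)
    ultimately show "\<exists>k\<in>?S. (1 - \<epsilon>) * real n < real k" by blast
  next
    assume "\<exists>k\<in>?S. (1 - \<epsilon>) * real n < real k"
    then obtain k where "k \<in> ?S" "(1 - \<epsilon>) * real n < real k" by blast
    moreover have "k \<le> Max ?S" using \<open>k \<in> ?S\<close> by (intro Max_ge finite_match_cards)
    ultimately show "(1 - \<epsilon>) * real n < real (Max ?S)" by linarith
  qed
  also have "\<dots> \<longleftrightarrow> y \<in> match_ball \<theta> T n \<omega> x \<epsilon>" by (auto simp: match_ball_def)
  finally show ?thesis .
qed

lemma match_ball_mono:
  assumes "\<epsilon> \<le> \<epsilon>'"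
  shows "match_ball \<theta> T n \<omega> x \<epsilon> \<subseteq> match_ball \<theta> T n \<omega> x \<epsilon>'"
proof
  fix y assume "y \<in> match_ball \<theta> T n \<omega> x \<epsilon>"
  then obtain D \<pi> where m: "is_match \<theta> T \<omega> n \<epsilon> x y D \<pi>" "(1 - \<epsilon>) * real n < real (card D)"
    by (auto simp: match_ball_def)
  have "is_match \<theta> T \<omega> n \<epsilon>' x y D \<pi>" using m(1) assms by (force simp: is_match_def)
  moreover have "(1 - \<epsilon>') * real n \<le> (1 - \<epsilon>) * real n" using assms by (intro mult_right_mono) auto
  ultimately show "y \<in> match_ball \<theta> T n \<omega> x \<epsilon>'" using m(2) by (fastforce simp: match_ball_def)
qed

text \<open>An infimum is below \<delta> iff some admissible \<epsilon> is, and monotonicity in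
  \<epsilon> allows a rational one. Countability of this union makes FK balls measurable.\<close>

lemma fk_ball_eq:
  assumes "n > 0"
  shows "fk_ball \<theta> T n \<omega> x \<delta> = (\<Union>\<epsilon>\<in>\<rat> \<inter> {0<..<\<delta>}. match_ball \<theta> T n \<omega> x \<epsilon>)"
proof (rule set_eqI)
  fix y
  let ?E = "{\<epsilon>. \<epsilon> > 0 \<and> fbar \<theta> T \<omega> n \<epsilon> x y < \<epsilon>}"
  \<comment> \<open>The value 2 is always admissible, so the infimum is taken over a nonempty set
    and is not a default value.\<close>
  have "fbar \<theta> T \<omega> n 2 x y \<le> 1" by (simp add: fbar_def)
  then have "2 \<in> ?E" by simp
  then have ne: "?E \<noteq> {}" by blast
  have bdd: "bdd_below ?E" by (rule bdd_belowI[of _ 0]) auto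
  have "y \<in> fk_ball \<theta> T n \<omega> x \<delta> \<longleftrightarrow> (\<exists>\<epsilon>>0. \<epsilon> < \<delta> \<and> y \<in> match_ball \<theta> T n \<omega> x \<epsilon>)"
    unfolding fk_ball_def fk_dist_def mem_Collect_eq cInf_less_iff[OF ne bdd]
    by (auto simp: fbar_less_iff[OF assms])
  also have "\<dots> \<longleftrightarrow> (\<exists>\<epsilon>\<in>\<rat> \<inter> {0<..<\<delta>}. y \<in> match_ball \<theta> T n \<omega> x \<epsilon>)"
  proof
    assume "\<exists>\<epsilon>>0. \<epsilon> < \<delta> \<and> y \<in> match_ball \<theta> T n \<omega> x \<epsilon>"
    then obtain \<epsilon> where \<epsilon>: "0 < \<epsilon>" "\<epsilon> < \<delta>" "y \<in> match_ball \<theta> T n \<omega> x \<epsilon>" by blast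
    obtain q where "q \<in> \<rat>" "\<epsilon> < q" "q < \<delta>" using Rats_dense_in_real[OF \<epsilon>(2)] by blast
    then show "\<exists>\<epsilon>\<in>\<rat> \<inter> {0<..<\<delta>}. y \<in> match_ball \<theta> T n \<omega> x \<epsilon>"
      using \<epsilon> match_ball_mono[of \<epsilon> q \<theta> T n \<omega> x] by (intro bexI[of _ q]) auto
  qed auto
  finally show "y \<in> fk_ball \<theta> T n \<omega> x \<delta> \<longleftrightarrow>
      y \<in> (\<Union>\<epsilon>\<in>\<rat> \<inter> {0<..<\<delta>}. match_ball \<theta> T n \<omega> x \<epsilon>)" by auto
qed

lemma fk_ball_subset_match_ball:
  "n > 0 \<Longrightarrow> fk_ball \<theta> T n \<omega> x \<delta> \<subseteq> match_ball \<theta> T n \<omega> x \<delta>"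
  unfolding fk_ball_eq by (intro UN_least match_ball_mono) auto

lemma fk_ball_mono: "n > 0 \<Longrightarrow> \<delta> \<le> \<delta>' \<Longrightarrow> fk_ball \<theta> T n \<omega> x \<delta> \<subseteq> fk_ball \<theta> T n \<omega> x \<delta>'"
  by (fastforce simp: fk_ball_eq)

lemma bowen_ball_eq:
  assumes "n > 0"
  shows "bowen_ball \<theta> T n \<omega> x \<delta> =
    {y. \<forall>i<n. dist (rds_iter \<theta> T i \<omega> x) (rds_iter \<theta> T i \<omega> y) < \<delta>}"
proof -
  have "{..<n} \<noteq> {}" using assms by auto
  then show ?thesis unfolding bowen_ball_def bowen_dist_def by (subst Max_less_iff) auto
qed

lemma bowen_ball_mono:
  "n > 0 \<Longrightarrow> \<delta> \<le> \<delta>' \<Longrightarrow> bowen_ball \<theta> T n \<omega> x \<delta> \<subseteq> bowen_ball \<theta> T n \<omega> x \<delta>'"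
  by (fastforce simp: bowen_ball_def)

lemma bowen_ball_subset_fk_ball:
  assumes "n > 0" "\<delta> > 0"
  shows "bowen_ball \<theta> T n \<omega> x \<delta> \<subseteq> fk_ball \<theta> T n \<omega> x \<delta>"
proof
  fix y assume y: "y \<in> bowen_ball \<theta> T n \<omega> x \<delta>"
  \<comment> \<open>The identity on all n times is a match with tolerance q; since q > 0, its length
    n strictly exceeds (1 - q) n.\<close>
  have "max 0 (bowen_dist \<theta> T n \<omega> x y) < \<delta>" using y assms by (auto simp: bowen_ball_def)
  then obtain q where q: "q \<in> \<rat>" "max 0 (bowen_dist \<theta> T n \<omega> x y) < q" "q < \<delta>"
    using Rats_dense_in_real by blast
  then have "y \<in> bowen_ball \<theta> T n \<omega> x q" by (simp add: bowen_ball_def)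
  then have "is_match \<theta> T \<omega> n q x y {..<n} id"
    by (auto simp: bowen_ball_eq[OF assms(1)] is_match_def strict_mono_on_def)
  moreover have "(1 - q) * real n < real (card {..<n})" using q assms by (auto simp: algebra_simps)
  ultimately have "y \<in> match_ball \<theta> T n \<omega> x q" unfolding match_ball_def by blast
  then show "y \<in> fk_ball \<theta> T n \<omega> x \<delta>" using q assms by (auto simp: fk_ball_eq)
qed

text \<open>Composing the match of \<open>x\<close> and \<open>y\<close> with the inverse of the match of \<open>z\<close> and \<open>y\<close>: the ranges
  of the two miss at most \<open>\<epsilon> n\<close> times each.\<close>

lemma match_ball_triangle:
  assumes "y \<in> match_ball \<theta> T n \<omega> x \<epsilon>" "y \<in> match_ball \<theta> T n \<omega> z \<epsilon>"
  shows "z \<in> match_ball \<theta> T n \<omega> x (2 * \<epsilon>)"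
proof -
  obtain D \<pi> where m: "is_match \<theta> T \<omega> n \<epsilon> x y D \<pi>" "(1 - \<epsilon>) * real n < real (card D)"
    using assms(1) by (auto simp: match_ball_def)
  obtain E \<rho> where k: "is_match \<theta> T \<omega> n \<epsilon> z y E \<rho>" "(1 - \<epsilon>) * real n < real (card E)"
    using assms(2) by (auto simp: match_ball_def)
  define F where "F = {i\<in>D. \<pi> i \<in> \<rho> ` E}"
  define \<sigma> where "\<sigma> i = inv_into E \<rho> (\<pi> i)" for i
  have inj: "inj_on \<pi> D" "inj_on \<rho> E" using m k by (auto simp: is_match_def strict_mono_on_imp_inj_on)
  have \<sigma>: "\<sigma> i \<in> E" "\<rho> (\<sigma> i) = \<pi> i" if "i \<in> F" for i
    using that by (auto simp: F_def \<sigma>_def inv_into_into f_inv_into_f)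
  have "strict_mono_on F \<sigma>"
  proof (rule strict_mono_onI)
    fix i j assume ij: "i \<in> F" "j \<in> F" "i < j"
    have "\<pi> i < \<pi> j" using ij m by (auto simp: is_match_def F_def strict_mono_on_def)
    then have "\<rho> (\<sigma> i) < \<rho> (\<sigma> j)" using ij \<sigma> by simp
    moreover have "\<sigma> j \<le> \<sigma> i \<Longrightarrow> \<rho> (\<sigma> j) \<le> \<rho> (\<sigma> i)"
      using k \<sigma> ij by (metis is_match_def less_le_not_le linorder_le_less_linear order.order_iff_strict strict_mono_on_def)
    ultimately show "\<sigma> i < \<sigma> j" by linarith
  qed
  moreover have "dist (rds_iter \<theta> T i \<omega> x) (rds_iter \<theta> T (\<sigma> i) \<omega> z) < 2 * \<epsilon>" if "i \<in> F" for i
  proof -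
    have "dist (rds_iter \<theta> T i \<omega> x) (rds_iter \<theta> T (\<pi> i) \<omega> y) < \<epsilon>"
      using m that by (auto simp: is_match_def F_def)
    moreover have "dist (rds_iter \<theta> T (\<sigma> i) \<omega> z) (rds_iter \<theta> T (\<pi> i) \<omega> y) < \<epsilon>"
      using k \<sigma>[OF that] by (metis is_match_def)
    ultimately show ?thesis
      using dist_triangle2[of "rds_iter \<theta> T i \<omega> x" "rds_iter \<theta> T (\<sigma> i) \<omega> z" "rds_iter \<theta> T (\<pi> i) \<omega> y"]
      by linarith
  qed
  ultimately have "is_match \<theta> T \<omega> n (2 * \<epsilon>) x z F \<sigma>"
    using m k \<sigma> unfolding is_match_def F_def by blast
  moreover have "(1 - 2 * \<epsilon>) * real n < real (card F)"
  proof -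
    have fin: "finite D" "finite E" using m k by (auto simp: is_match_def intro: finite_subset)
    have sub: "\<pi> ` D \<union> \<rho> ` E \<subseteq> {..<n}" using m k by (auto simp: is_match_def)
    have "card D + card E = card (\<pi> ` D) + card (\<rho> ` E)" using inj by (simp add: card_image)
    also have "\<dots> = card (\<pi> ` D \<union> \<rho> ` E) + card (\<pi> ` D \<inter> \<rho> ` E)" using fin by (intro card_Un_Int) auto
    also have "card (\<pi> ` D \<union> \<rho> ` E) \<le> n" using card_mono[OF _ sub] by simp
    also have "\<pi> ` D \<inter> \<rho> ` E = \<pi> ` F" by (auto simp: F_def)
    also have "card (\<pi> ` F) = card F" using inj by (intro card_image) (auto simp: F_def inj_on_def)
    finally have "real (card D) + real (card E) \<le> real n + real (card F)" by linarith
    then show ?thesis using m(2) k(2) by (simp add: algebra_simps)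
  qed
  ultimately show ?thesis by (auto simp: match_ball_def)
qed

text \<open>Dropping time 0 on both sides destroys at most two pairs, the one starting at 0 and the
  one ending at 0. Halving the tolerance beforehand pays for this loss once \<delta> n is
  large.\<close>

lemma match_ball_shift:
  assumes "y \<in> match_ball \<theta> T (Suc n) \<omega> x (\<delta> / 2)" "\<delta> > 0" "4 + \<delta> \<le> \<delta> * real n"
  shows "T \<omega> y \<in> match_ball \<theta> T n (\<theta> \<omega>) (T \<omega> x) \<delta>"
proof -
  obtain D \<pi> where m: "is_match \<theta> T \<omega> (Suc n) (\<delta> / 2) x y D \<pi>"
    "(1 - \<delta> / 2) * real (Suc n) < real (card D)"
    using assms(1) by (auto simp: match_ball_def)
  define E where "E = {i. Suc i \<in> D \<and> \<pi> (Suc i) \<noteq> 0}"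
  \<comment> \<open>The truncated subtraction is harmless, since E excludes the value 0.\<close>
  define \<rho> where "\<rho> i = \<pi> (Suc i) - 1" for i
  have Suc_iter: "rds_iter \<theta> T (Suc i) \<omega> z = rds_iter \<theta> T i (\<theta> \<omega>) (T \<omega> z)" for i z
    using rds_iter_add[of \<theta> T 1 i \<omega> z] by simp
  have D: "D \<subseteq> {..<Suc n}" "\<pi> ` D \<subseteq> {..<Suc n}" "strict_mono_on D \<pi>"
    "\<And>i. i \<in> D \<Longrightarrow> dist (rds_iter \<theta> T i \<omega> x) (rds_iter \<theta> T (\<pi> i) \<omega> y) < \<delta> / 2"
    using m by (auto simp: is_match_def)
  have fin: "finite D" using D(1) by (rule finite_subset) simp
  have "E \<subseteq> {..<n}" using D by (auto simp: E_def)
  moreover have "\<rho> ` E \<subseteq> {..<n}" using D by (fastforce simp: E_def \<rho>_def)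
  moreover have "strict_mono_on E \<rho>"
  proof (rule strict_mono_onI)
    fix i j assume "i \<in> E" "j \<in> E" "i < j"
    then have "\<pi> (Suc i) < \<pi> (Suc j)" "\<pi> (Suc i) \<noteq> 0"
      using D(3) by (auto simp: E_def strict_mono_on_def)
    then show "\<rho> i < \<rho> j" by (auto simp: \<rho>_def)
  qed
  moreover have "dist (rds_iter \<theta> T i (\<theta> \<omega>) (T \<omega> x)) (rds_iter \<theta> T (\<rho> i) (\<theta> \<omega>) (T \<omega> y)) < \<delta>"
    if "i \<in> E" for i
  proof -
    have "Suc (\<rho> i) = \<pi> (Suc i)" using that by (auto simp: E_def \<rho>_def)
    then have "dist (rds_iter \<theta> T (Suc i) \<omega> x) (rds_iter \<theta> T (Suc (\<rho> i)) \<omega> y) < \<delta> / 2"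
      using D(4)[of "Suc i"] that by (simp add: E_def)
    then show ?thesis using assms(2) unfolding Suc_iter by linarith
  qed
  ultimately have "is_match \<theta> T (\<theta> \<omega>) n \<delta> (T \<omega> x) (T \<omega> y) E \<rho>" by (auto simp: is_match_def)
  moreover have "(1 - \<delta>) * real n < real (card E)"
  proof -
    have z: "card {i\<in>D. \<pi> i = 0} \<le> 1"
      using strict_mono_on_imp_inj_on[OF D(3)] by (auto simp: card_le_Suc0_iff_eq fin inj_on_def)
    have "D \<subseteq> insert 0 ({i\<in>D. \<pi> i = 0} \<union> Suc ` E)"
    proof
      fix i assume "i \<in> D"
      then show "i \<in> insert 0 ({i\<in>D. \<pi> i = 0} \<union> Suc ` E)" by (cases i) (auto simp: E_def)
    qed
    then have "card D \<le> card (insert 0 ({i\<in>D. \<pi> i = 0} \<union> Suc ` E))"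
      using fin \<open>E \<subseteq> {..<n}\<close> by (intro card_mono) (auto intro: finite_subset)
    also have "\<dots> \<le> Suc (card ({i\<in>D. \<pi> i = 0} \<union> Suc ` E))" by (rule card_insert_le_m1) auto
    also have "\<dots> \<le> Suc (1 + card E)" using z card_Un_le[of "{i\<in>D. \<pi> i = 0}" "Suc ` E"]
      by (simp add: card_image)
    finally have "real (card D) \<le> 2 + real (card E)" by simp
    moreover have "real n + 1 - \<delta> / 2 - \<delta> * real n / 2 < real (card D)"
      using m(2) by (simp add: field_simps)
    ultimately show ?thesis using assms(2,3) unfolding left_diff_distrib by linarith
  qed
  ultimately show ?thesis by (auto simp: match_ball_def)
qed

section \<open>Covering by sets of small Bowen diameter\<close>

text \<open>A bound on the covering number by sets of Bowen diameter below \<eta>. The bound k is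
  real so that exponentials can be inserted directly; the covering sets are arbitrary, neither
  measurable nor contained in S.\<close>

definition spanned ::
  "('w \<Rightarrow> 'w) \<Rightarrow> ('w \<Rightarrow> 'x \<Rightarrow> 'x :: metric_space) \<Rightarrow> real \<Rightarrow> 'w \<Rightarrow> nat \<Rightarrow> 'x set \<Rightarrow> real \<Rightarrow> bool" where
  "spanned \<theta> T \<eta> \<omega> n S k \<longleftrightarrow>
     (\<exists>\<C>. finite \<C> \<and> real (card \<C>) \<le> k \<and> S \<subseteq> \<Union>\<C> \<and>
        (\<forall>C\<in>\<C>. \<forall>y\<in>C. \<forall>z\<in>C. \<forall>i<n. dist (rds_iter \<theta> T i \<omega> y) (rds_iter \<theta> T i \<omega> z) < \<eta>))"

lemma spanned_mono:
  assumes "spanned \<theta> T \<eta> \<omega> n S k" "S' \<subseteq> S" "k \<le> k'"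
  shows "spanned \<theta> T \<eta> \<omega> n S' k'"
proof -
  obtain \<C> where "finite \<C>" "real (card \<C>) \<le> k" "S \<subseteq> \<Union>\<C>"
    "\<forall>C\<in>\<C>. \<forall>y\<in>C. \<forall>z\<in>C. \<forall>i<n. dist (rds_iter \<theta> T i \<omega> y) (rds_iter \<theta> T i \<omega> z) < \<eta>"
    using assms(1) by (auto simp: spanned_def)
  with assms(2,3) show ?thesis unfolding spanned_def by (intro exI[of _ \<C>] conjI) auto
qed

lemma spanned_UN:
  assumes "finite I" "\<And>i. i \<in> I \<Longrightarrow> spanned \<theta> T \<eta> \<omega> n (S i) (k i)"
  shows "spanned \<theta> T \<eta> \<omega> n (\<Union>i\<in>I. S i) (\<Sum>i\<in>I. k i)"
proof -
  obtain \<C> where \<C>: "\<And>i. i \<in> I \<Longrightarrow> finite (\<C> i)" "\<And>i. i \<in> I \<Longrightarrow> real (card (\<C> i)) \<le> k i"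
    "\<And>i. i \<in> I \<Longrightarrow> S i \<subseteq> \<Union>(\<C> i)"
    "\<And>i. i \<in> I \<Longrightarrow> \<forall>C\<in>\<C> i. \<forall>y\<in>C. \<forall>z\<in>C. \<forall>j<n. dist (rds_iter \<theta> T j \<omega> y) (rds_iter \<theta> T j \<omega> z) < \<eta>"
    using assms(2) unfolding spanned_def by metis
  have "real (card (\<Union>i\<in>I. \<C> i)) \<le> real (\<Sum>i\<in>I. card (\<C> i))"
    using card_UN_le[OF assms(1), of \<C>] by linarith
  also have "\<dots> \<le> (\<Sum>i\<in>I. k i)" using \<C>(2) by (auto intro: sum_mono)
  finally show ?thesis
    unfolding spanned_def
  proof (intro exI[of _ "\<Union>i\<in>I. \<C> i"] conjI)
    show "finite (\<Union>i\<in>I. \<C> i)" using \<C>(1) assms(1) by blast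
    show "(\<Union>i\<in>I. S i) \<subseteq> \<Union>(\<Union>i\<in>I. \<C> i)" using \<C>(3) by blast
    show "\<forall>C\<in>\<Union>i\<in>I. \<C> i. \<forall>y\<in>C. \<forall>z\<in>C. \<forall>j<n. dist (rds_iter \<theta> T j \<omega> y) (rds_iter \<theta> T j \<omega> z) < \<eta>"
      using \<C>(4) by (intro ballI) (elim UN_E, simp)
  qed
qed

lemma spanned_Un:
  assumes "spanned \<theta> T \<eta> \<omega> n S k" "spanned \<theta> T \<eta> \<omega> n S' k'"
  shows "spanned \<theta> T \<eta> \<omega> n (S \<union> S') (k + k')"
proof -
  have "spanned \<theta> T \<eta> \<omega> n (\<Union>b\<in>UNIV. if b then S else S') (\<Sum>b\<in>UNIV. if b then k else k')"
    using assms by (intro spanned_UN) auto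
  then show ?thesis by (simp add: UNIV_bool Un_commute add.commute)
qed

text \<open>Intersecting a covering set with the preimage of another multiplies the counts and loses
  nothing in \<eta>. This is the reason for diameters: with balls, the centres would not survive the
  intersection.\<close>

lemma spanned_concat:
  assumes "spanned \<theta> T \<eta> \<omega> n S k" "spanned \<theta> T \<eta> ((\<theta> ^^ n) \<omega>) m S' k'"
  shows "spanned \<theta> T \<eta> \<omega> (n + m) {x\<in>S. rds_iter \<theta> T n \<omega> x \<in> S'} (k * k')"
proof -
  obtain \<C> where \<C>: "finite \<C>" "real (card \<C>) \<le> k" "S \<subseteq> \<Union>\<C>"
    "\<forall>C\<in>\<C>. \<forall>y\<in>C. \<forall>z\<in>C. \<forall>i<n. dist (rds_iter \<theta> T i \<omega> y) (rds_iter \<theta> T i \<omega> z) < \<eta>"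
    using assms(1) unfolding spanned_def by (elim exE conjE)
  obtain \<D> where \<D>: "finite \<D>" "real (card \<D>) \<le> k'" "S' \<subseteq> \<Union>\<D>"
    "\<forall>C\<in>\<D>. \<forall>y\<in>C. \<forall>z\<in>C. \<forall>i<m.
       dist (rds_iter \<theta> T i ((\<theta> ^^ n) \<omega>) y) (rds_iter \<theta> T i ((\<theta> ^^ n) \<omega>) z) < \<eta>"
    using assms(2) unfolding spanned_def by (elim exE conjE)
  define \<E> where "\<E> = (\<lambda>(C, D). C \<inter> rds_iter \<theta> T n \<omega> -` D) ` (\<C> \<times> \<D>)"
  have "card \<E> \<le> card (\<C> \<times> \<D>)" unfolding \<E>_def using \<C>(1) \<D>(1) by (intro card_image_le) auto
  also have "\<dots> = card \<C> * card \<D>" by (rule card_cartesian_product)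
  finally have "real (card \<E>) \<le> real (card \<C>) * real (card \<D>)" by (metis of_nat_le_iff of_nat_mult)
  also have "\<dots> \<le> k * k'" using \<C>(2) \<D>(2) by (intro mult_mono) auto
  finally have card: "real (card \<E>) \<le> k * k'" .
  have close: "dist (rds_iter \<theta> T i \<omega> y) (rds_iter \<theta> T i \<omega> z) < \<eta>"
    if "A \<in> \<E>" "y \<in> A" "z \<in> A" "i < n + m" for A y z i
  proof -
    obtain C D where CD: "C \<in> \<C>" "D \<in> \<D>" "A = C \<inter> rds_iter \<theta> T n \<omega> -` D"
      using \<open>A \<in> \<E>\<close> by (auto simp: \<E>_def)
    show ?thesis
    proof (cases "i < n")
      case True
      then show ?thesis using \<C>(4) CD(1) that CD(3) by simp
    next
      case False
      then obtain j where j: "i = n + j" "j < m" using \<open>i < n + m\<close>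
        by (metis add_diff_inverse_nat add_less_cancel_left)
      then show ?thesis unfolding j(1) rds_iter_add using \<D>(4) CD(2) that CD(3) by simp
    qed
  qed
  have "{x\<in>S. rds_iter \<theta> T n \<omega> x \<in> S'} \<subseteq> \<Union>\<E>"
    using \<C>(3) \<D>(3) unfolding \<E>_def by fastforce
  moreover have "finite \<E>" using \<C>(1) \<D>(1) by (simp add: \<E>_def)
  ultimately show ?thesis unfolding spanned_def using card close
    by (intro exI[of _ \<E>] conjI ballI allI impI)
qed

text \<open>The fibres of the code are the covering sets, so covering reduces to counting code
  words.\<close>

lemma spanned_code:
  assumes "finite K" "\<And>y. y \<in> S \<Longrightarrow> code y \<in> K"
    and "\<And>y z i. \<lbrakk>y \<in> S; z \<in> S; code y = code z; i < n\<rbrakk> \<Longrightarrow>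
      dist (rds_iter \<theta> T i \<omega> y) (rds_iter \<theta> T i \<omega> z) < \<eta>"
  shows "spanned \<theta> T \<eta> \<omega> n S (real (card K))"
proof -
  let ?\<C> = "(\<lambda>c. {y\<in>S. code y = c}) ` K"
  have "card ?\<C> \<le> card K" by (intro card_image_le assms(1))
  then show ?thesis unfolding spanned_def using assms by (intro exI[of _ ?\<C>] conjI) auto
qed

lemma spanned_one:
  fixes T :: "'w \<Rightarrow> 'x \<Rightarrow> 'x :: metric_space"
  assumes "finite Z" "\<And>x::'x. \<exists>z\<in>Z. dist x z < \<eta> / 2"
  shows "spanned \<theta> T \<eta> \<omega> 1 S (real (card Z))"
proof -
  obtain c where c: "\<And>x. c x \<in> Z" "\<And>x. dist x (c x) < \<eta> / 2" using assms(2) by metis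
  show ?thesis
  proof (rule spanned_code[OF assms(1), where code = c])
    fix y z and i :: nat assume "c y = c z" "i < 1"
    then show "dist (rds_iter \<theta> T i \<omega> y) (rds_iter \<theta> T i \<omega> z) < \<eta>"
      using c(2)[of y] c(2)[of z] dist_triangle2[of y z "c y"] by simp
  qed (use c in auto)
qed

lemma spanned_all:
  fixes T :: "'w \<Rightarrow> 'x \<Rightarrow> 'x :: metric_space"
  assumes "finite Z" "\<And>x::'x. \<exists>z\<in>Z. dist x z < \<eta> / 2"
  shows "spanned \<theta> T \<eta> \<omega> n S (real (card Z) ^ n)"
proof (induction n arbitrary: \<omega> S)
  case 0
  show ?case unfolding spanned_def by (intro exI[of _ "{S}"]) auto
next
  case (Suc n)
  have "spanned \<theta> T \<eta> \<omega> (1 + n) {x\<in>S. rds_iter \<theta> T 1 \<omega> x \<in> UNIV} (real (card Z) * real (card Z) ^ n)"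
    by (intro spanned_concat spanned_one assms Suc.IH)
  then show ?case by simp
qed

section \<open>Subexponential covers of match balls by weighted counting of code words\<close>

text \<open>A Chernoff-type count: the weights of all words sum to the n-th power of the total
  letter weight, and each word in S contributes at least \<beta>. Giving rare letters a small weight
  replaces estimates of binomial coefficients.\<close>

lemma weighted_card_PiE_le:
  fixes w :: "'a \<Rightarrow> real"
  assumes "finite A" "\<And>a. a \<in> A \<Longrightarrow> 0 \<le> w a" "S \<subseteq> PiE {..<n} (\<lambda>_. A)"
    "\<And>g. g \<in> S \<Longrightarrow> \<beta> \<le> (\<Prod>i<n. w (g i))"
  shows "real (card S) * \<beta> \<le> (\<Sum>a\<in>A. w a) ^ n"
proof -
  have fin: "finite (PiE {..<n} (\<lambda>_. A))" using assms(1) by (intro finite_PiE) auto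
  have "real (card S) * \<beta> = (\<Sum>g\<in>S. \<beta>)" by simp
  also have "\<dots> \<le> (\<Sum>g\<in>S. \<Prod>i<n. w (g i))" by (intro sum_mono assms(4))
  also have "\<dots> \<le> (\<Sum>g\<in>PiE {..<n} (\<lambda>_. A). \<Prod>i<n. w (g i))"
    using assms(2,3) fin by (intro sum_mono2 prod_nonneg) (auto simp: PiE_iff)
  also have "\<dots> = (\<Prod>i<n. \<Sum>a\<in>A. w a)" using assms(1) by (intro prod_sum_PiE[symmetric]) auto
  finally show ?thesis by simp
qed

text \<open>An increasing map preserves ranks, so f i is the element of the range whose rank is that
  of i in D. Hence a code need only record the domain and the range of a match, not the match
  itself.\<close>

lemma strict_mono_on_determined:
  fixes f g :: "nat \<Rightarrow> nat"
  assumes "finite D" "strict_mono_on D f" "strict_mono_on D g" "f ` D = g ` D" "i \<in> D"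
  shows "f i = g i"
proof -
  have rank: "card {j\<in>h ` D. j < h i} = card {k\<in>D. k < i}" if h: "strict_mono_on D h" for h :: "nat \<Rightarrow> nat"
  proof -
    have "h k < h i \<longleftrightarrow> k < i" if "k \<in> D" for k
      using h that assms(5) by (simp add: strict_mono_on_less)
    then have "{j\<in>h ` D. j < h i} = h ` {k\<in>D. k < i}" by auto
    moreover have "inj_on h {k\<in>D. k < i}"
      using strict_mono_on_imp_inj_on[OF h] by (rule inj_on_subset) auto
    ultimately show ?thesis by (simp add: card_image)
  qed
  have less: False if "strict_mono_on D h" "strict_mono_on D h'" "h ` D = h' ` D" "h i < h' i"
    for h h' :: "nat \<Rightarrow> nat"
  proof -
    have "{j\<in>h ` D. j < h i} \<subset> {j\<in>h ` D. j < h' i}" using that(4) assms(5) by auto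
    then have "card {j\<in>h ` D. j < h i} < card {j\<in>h ` D. j < h' i}"
      using assms(1) by (intro psubset_card_mono) auto
    then show False using rank[OF that(1)] rank[OF that(2)] that(3) by simp
  qed
  show ?thesis using less[OF assms(2,3,4)] less[OF assms(3,2) assms(4)[symmetric]]
    by (cases "f i" "g i" rule: linorder_cases) auto
qed

text \<open>A point \<open>y\<close> of the match ball is encoded by the unmatched times of \<open>x\<close> and, at the unmatched
  times of \<open>y\<close>, by a nearby point of the net \<open>Z\<close>. The positions of both kinds get weight \<open>t\<close>.\<close>

lemma spanned_match_ball:
  fixes T :: "'w \<Rightarrow> 'x \<Rightarrow> 'x :: metric_space"
  assumes Z: "finite Z" "\<And>x::'x. \<exists>z\<in>Z. dist x z < \<eta> / 2"
    and "\<epsilon> \<le> \<eta> / 2" "0 < t" "t \<le> 1"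
  shows "spanned \<theta> T \<eta> \<omega> n (match_ball \<theta> T n \<omega> x \<epsilon>)
    (t powr (- 2 * \<epsilon> * real n) * ((1 + t) * (1 + t * real (card Z))) ^ n)"
proof -
  obtain c where c: "\<And>x. c x \<in> Z" "\<And>x. dist x (c x) < \<eta> / 2" using Z(2) by metis
  have "\<forall>y\<in>match_ball \<theta> T n \<omega> x \<epsilon>. \<exists>D \<pi>. is_match \<theta> T \<omega> n \<epsilon> x y D \<pi> \<and> (1 - \<epsilon>) * real n < real (card D)"
    by (auto simp: match_ball_def)
  then obtain D \<pi> where D: "\<And>y. y \<in> match_ball \<theta> T n \<omega> x \<epsilon> \<Longrightarrow> is_match \<theta> T \<omega> n \<epsilon> x y (D y) (\<pi> y)"
    "\<And>y. y \<in> match_ball \<theta> T n \<omega> x \<epsilon> \<Longrightarrow> (1 - \<epsilon>) * real n < real (card (D y))" by metis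
  define R where "R y = \<pi> y ` D y" for y
  define code where "code y = (\<lambda>i\<in>{..<n}. (i \<in> D y,
    if i \<in> R y then None else Some (c (rds_iter \<theta> T i \<omega> y))))" for y
  define A where "A = (UNIV :: bool set) \<times> insert None (Some ` Z)"
  define w :: "bool \<times> 'x option \<Rightarrow> real"
    where "w = (\<lambda>(b, l). (if b then 1 else t) * (if l = None then 1 else t))"
  let ?B = "match_ball \<theta> T n \<omega> x \<epsilon>"
  have DR: "D y \<subseteq> {..<n}" "R y \<subseteq> {..<n}" "strict_mono_on (D y) (\<pi> y)" "card (R y) = card (D y)"
    "finite (D y)" "finite (R y)" if "y \<in> ?B" for y
    using D(1)[OF that]
    by (auto simp: is_match_def R_def strict_mono_on_imp_inj_on intro!: card_image intro: finite_subset)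
  have codes: "code ` ?B \<subseteq> PiE {..<n} (\<lambda>_. A)"
    unfolding code_def by (intro image_subsetI restrict_PiE_iff[THEN iffD2]) (auto simp: A_def c(1))
  have span: "spanned \<theta> T \<eta> \<omega> n ?B (real (card (code ` ?B)))"
  proof (rule spanned_code)
    show "finite (code ` ?B)"
      using codes by (rule finite_subset) (use Z(1) in \<open>auto intro!: finite_PiE simp: A_def\<close>)
  next
    fix y z i assume y: "y \<in> ?B" and z: "z \<in> ?B" and code: "code y = code z" and i: "i < n"
    have at: "(j \<in> D y \<longleftrightarrow> j \<in> D z) \<and> (j \<in> R y \<longleftrightarrow> j \<in> R z) \<and>
      (j \<notin> R y \<longrightarrow> c (rds_iter \<theta> T j \<omega> y) = c (rds_iter \<theta> T j \<omega> z))" if "j < n" for j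
      using fun_cong[OF code, of j] that by (auto simp: code_def split: if_splits)
    have eq: "D y = D z" "R y = R z" using at DR(1,2)[OF y] DR(1,2)[OF z] by blast+
    \<comment> \<open>The pivot p is the orbit point of x matched to time i, or the common net point
      if i is unmatched in y.\<close>
    obtain p where p: "dist p (rds_iter \<theta> T i \<omega> y) < \<eta> / 2" "dist p (rds_iter \<theta> T i \<omega> z) < \<eta> / 2"
    proof (cases "i \<in> R y")
      case True
      then obtain j where j: "j \<in> D y" "i = \<pi> y j" by (auto simp: R_def)
      have "\<pi> y j = \<pi> z j"
        using DR[OF y] DR[OF z] eq j(1) by (intro strict_mono_on_determined[of "D y"]) (auto simp: R_def)
      then have "dist (rds_iter \<theta> T j \<omega> x) (rds_iter \<theta> T i \<omega> y) < \<epsilon>"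
        "dist (rds_iter \<theta> T j \<omega> x) (rds_iter \<theta> T i \<omega> z) < \<epsilon>"
        using D(1)[OF y] D(1)[OF z] j eq by (auto simp: is_match_def)
      then show ?thesis using assms(3) by (intro that[of "rds_iter \<theta> T j \<omega> x"]) linarith+
    next
      case False
      then have "c (rds_iter \<theta> T i \<omega> y) = c (rds_iter \<theta> T i \<omega> z)" using at[OF i] by blast
      then show ?thesis using c(2) by (metis that dist_commute)
    qed
    then show "dist (rds_iter \<theta> T i \<omega> y) (rds_iter \<theta> T i \<omega> z) < \<eta>"
      using dist_triangle3[of "rds_iter \<theta> T i \<omega> y" "rds_iter \<theta> T i \<omega> z" p] by linarith
  qed auto
  have "real (card (code ` ?B)) * t powr (2 * \<epsilon> * real n) \<le> (\<Sum>a\<in>A. w a) ^ n"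
  proof (rule weighted_card_PiE_le)
    show "code ` ?B \<subseteq> PiE {..<n} (\<lambda>_. A)" by (rule codes)
    fix g assume "g \<in> code ` ?B"
    then obtain y where y: "y \<in> ?B" "g = code y" by blast
    have compl: "(\<Prod>i<n. if i \<in> E then 1 else t) = t ^ (n - card E)" if "E \<subseteq> {..<n}" for E
    proof -
      have "(\<Prod>i<n. if i \<in> E then 1 else t) = t ^ card ({..<n} \<inter> - E)"
        by (simp add: prod.If_cases)
      also have "card ({..<n} \<inter> - E) = n - card E"
        using that finite_subset[OF that] by (simp add: card_Diff_subset flip: Diff_eq)
      finally show ?thesis .
    qed
    have "(\<Prod>i<n. w (g i)) = (\<Prod>i<n. (if i \<in> D y then 1 else t) * (if i \<in> R y then 1 else t))"
      unfolding y(2) by (intro prod.cong) (auto simp: code_def w_def)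
    also have "\<dots> = t ^ (n - card (D y)) * t ^ (n - card (D y))"
      using DR[OF y(1)] by (simp add: prod.distrib compl)
    also have "\<dots> = t powr (2 * real (n - card (D y)))"
      using assms(4) by (simp add: powr_realpow[symmetric] powr_add[symmetric])
    \<comment> \<open>Domain and range have equal size, so each kind of unmatched time occurs fewer
      than \<epsilon> n times; as t \<le> 1, the weight is at least t to the power 2 \<epsilon>
      n.\<close>
    also have "t powr (2 * \<epsilon> * real n) \<le> \<dots>"
    proof (rule powr_mono')
      have "card (D y) \<le> n" using card_mono[OF _ DR(1)[OF y(1)]] by simp
      then show "2 * real (n - card (D y)) \<le> 2 * \<epsilon> * real n"
        using D(2)[OF y(1)] by (simp add: of_nat_diff algebra_simps)
    qed (use assms in auto)
    finally show "t powr (2 * \<epsilon> * real n) \<le> (\<Prod>i<n. w (g i))" .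
  qed (use Z(1) assms(4) in \<open>auto simp: A_def w_def\<close>)
  also have "(\<Sum>a\<in>A. w a) = (1 + t) * (1 + t * real (card Z))"
  proof -
    have "(\<Sum>a\<in>A. w a) = (\<Sum>b\<in>UNIV. \<Sum>l\<in>insert None (Some ` Z). (if b then 1 else t) * (if l = None then 1 else t))"
      unfolding A_def w_def using Z(1) by (subst sum.cartesian_product) (auto simp: split_def)
    also have "\<dots> = (\<Sum>b\<in>UNIV. if b then 1 else t) * (\<Sum>l\<in>insert None (Some ` Z). if l = None then 1 else t)"
      by (simp only: sum_product)
    also have "(\<Sum>l\<in>insert None (Some ` Z). if l = None then 1 else t) = 1 + t * real (card Z)"
      using Z(1) by (subst sum.insert) (auto simp: sum.reindex)
    finally show ?thesis by (simp add: UNIV_bool)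
  qed
  finally have "real (card (code ` ?B)) \<le> t powr (- 2 * \<epsilon> * real n) * ((1 + t) * (1 + t * real (card Z))) ^ n"
    using assms(4) by (simp add: powr_minus field_simps)
  with span show ?thesis by (rule spanned_mono[OF _ order_refl])
qed

text \<open>Two factors are each kept below exp (\<rho> n / 2). The weight t is fixed so that the
  letters contribute at most exp (\<rho> / 2) per time; only afterwards is \<epsilon> made small in
  terms of t, to control t to the power -2 \<epsilon> n.\<close>

lemma ex_spanned_match_ball:
  fixes T :: "'w \<Rightarrow> 'x \<Rightarrow> 'x :: metric_space"
  assumes Z: "finite Z" "\<And>x::'x. \<exists>z\<in>Z. dist x z < \<eta> / 2" and "\<rho> > 0" "\<eta> > 0"
  obtains \<epsilon> where "\<epsilon> > 0"
    "\<And>\<omega> n x. spanned \<theta> T \<eta> \<omega> n (match_ball \<theta> T n \<omega> x \<epsilon>) (exp (\<rho> * real n))"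
proof -
  define k where "k = real (card Z)"
  define t where "t = min 1 (\<rho> / (2 * (1 + k)))"
  have k: "k \<ge> 0" by (simp add: k_def)
  have t: "0 < t" "t \<le> 1" using assms(3) k by (auto simp: t_def)
  have "t * (1 + k) \<le> \<rho> / (2 * (1 + k)) * (1 + k)" using k by (intro mult_right_mono) (auto simp: t_def)
  also have "\<dots> = \<rho> / 2" using k by (simp add: field_simps)
  finally have tk: "t * (1 + k) \<le> \<rho> / 2" .
  have lnt: "ln t \<le> 0" using t by simp
  \<comment> \<open>The denominator uses 1 - ln t, which is at least 1 even when t = 1.\<close>
  define \<epsilon> where "\<epsilon> = min (\<eta> / 2) (\<rho> / (4 * (1 - ln t)))"
  have \<epsilon>: "\<epsilon> > 0" using assms(3,4) lnt by (auto simp: \<epsilon>_def)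
  have \<epsilon>': "\<epsilon> \<le> \<eta> / 2" unfolding \<epsilon>_def by (rule min.cobounded1)
  have "\<epsilon> * (1 - ln t) \<le> \<rho> / (4 * (1 - ln t)) * (1 - ln t)"
    using lnt by (intro mult_right_mono) (auto simp: \<epsilon>_def)
  also have "\<dots> = \<rho> / 4" using lnt by (simp add: field_simps)
  finally have \<epsilon>t: "- (2 * \<epsilon> * ln t) \<le> \<rho> / 2" using \<epsilon> by (simp add: algebra_simps)
  have bound: "t powr (- 2 * \<epsilon> * real n) * ((1 + t) * (1 + t * k)) ^ n \<le> exp (\<rho> * real n)" for n
  proof -
    have "(1 + t) * (1 + t * k) \<le> exp t * exp (t * k)"
      using t k by (intro mult_mono exp_ge_add_one_self) auto
    also have "\<dots> \<le> exp (\<rho> / 2)" using tk by (simp add: exp_add[symmetric] algebra_simps)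
    finally have "((1 + t) * (1 + t * k)) ^ n \<le> exp (\<rho> / 2) ^ n" using t k by (intro power_mono) auto
    also have "\<dots> = exp (\<rho> / 2 * real n)" by (simp add: exp_of_nat_mult[symmetric] mult.commute)
    finally have 1: "((1 + t) * (1 + t * k)) ^ n \<le> exp (\<rho> / 2 * real n)" .
    have "t powr (- 2 * \<epsilon> * real n) = exp (- (2 * \<epsilon> * ln t) * real n)"
      using t by (simp add: powr_def mult_ac)
    also have "\<dots> \<le> exp (\<rho> / 2 * real n)" using mult_right_mono[OF \<epsilon>t, of "real n"] by simp
    finally have 2: "t powr (- 2 * \<epsilon> * real n) \<le> exp (\<rho> / 2 * real n)" .
    have "t powr (- 2 * \<epsilon> * real n) * ((1 + t) * (1 + t * k)) ^ n \<le> exp (\<rho> / 2 * real n) * exp (\<rho> / 2 * real n)"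
      using 1 2 t k by (intro mult_mono) auto
    also have "\<dots> = exp (\<rho> * real n)" by (simp add: exp_add[symmetric])
    finally show ?thesis .
  qed
  show ?thesis
  proof (rule that[OF \<epsilon>])
    fix \<omega> n x
    show "spanned \<theta> T \<eta> \<omega> n (match_ball \<theta> T n \<omega> x \<epsilon>) (exp (\<rho> * real n))"
      using spanned_match_ball[OF Z \<epsilon>' t] order_refl bound[of n, unfolded k_def]
      by (rule spanned_mono)
  qed
qed

text \<open>Cutting the time interval \<open>[0, N)\<close> greedily into tiles \<open>[s, s + n)\<close> at whose starting point the
  orbit lies in \<open>Q n\<close>, and single times (holes), of which there are at most \<open>h + M\<close>. The counting
  bound is a recursion on the first tile.\<close>

lemma spanned_tiling:
  fixes T :: "'w \<Rightarrow> 'x \<Rightarrow> 'x :: metric_space"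
  assumes Z: "finite Z" "\<And>x::'x. \<exists>z\<in>Z. dist x z < \<eta> / 2"
    and inv: "\<And>\<omega>. \<omega> \<in> \<Omega> \<Longrightarrow> \<theta> \<omega> \<in> \<Omega>"
    and Q: "\<And>\<omega> n. \<lbrakk>\<omega> \<in> \<Omega>; n0 \<le> n; n \<le> M\<rbrakk> \<Longrightarrow> spanned \<theta> T \<eta> \<omega> n (Q n \<omega>) (exp (b * real n))"
    and W: "1 \<le> W" "2 * real (card Z) \<le> W"
    and b: "0 \<le> b'" "(\<Sum>n=n0..M. exp (- (b' - b) * real n)) \<le> 1 / 2"
    and n0: "1 \<le> n0" and \<omega>: "\<omega> \<in> \<Omega>"
  shows "spanned \<theta> T \<eta> \<omega> N
    {x. card {i. i < N \<and> (\<forall>n\<in>{n0..M}. rds_iter \<theta> T i \<omega> x \<notin> Q n ((\<theta> ^^ i) \<omega>))} \<le> h}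
    (W ^ (h + M) * exp (b' * real N))"
  using \<omega>
proof (induction N arbitrary: h \<omega> rule: less_induct)
  case (less N)
  define H where "H N \<omega> x = {i. i < N \<and> (\<forall>n\<in>{n0..M}. rds_iter \<theta> T i \<omega> x \<notin> Q n ((\<theta> ^^ i) \<omega>))}"
    for N \<omega> and x :: 'x
  define S where "S N \<omega> h = {x. card (H N \<omega> x) \<le> h}" for N \<omega> h
  have IH: "spanned \<theta> T \<eta> \<omega>' m (S m \<omega>' h') (W ^ (h' + M) * exp (b' * real m))" if "m < N" "\<omega>' \<in> \<Omega>" for m \<omega>' h'
    using less.IH[OF that] by (simp add: S_def H_def)
  have fin: "finite (H N \<omega> x)" for N \<omega> x by (simp add: H_def)
  have shift: "(+) n ` H (N - n) ((\<theta> ^^ n) \<omega>) (rds_iter \<theta> T n \<omega> x) \<subseteq> H N \<omega> x" if "n \<le> N" for n x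
  proof -
    have "(\<theta> ^^ (n + i)) \<omega> = (\<theta> ^^ i) ((\<theta> ^^ n) \<omega>)" for i by (metis add.commute comp_apply funpow_add)
    then show ?thesis using that by (auto simp: H_def rds_iter_add)
  qed
  have "spanned \<theta> T \<eta> \<omega> N (S N \<omega> h) (W ^ (h + M) * exp (b' * real N))"
  \<comment> \<open>A stretch too short for the longest tile is covered crudely by net itineraries;
    this is the source of the summand M in the exponent of W. Otherwise M \<le> N and every tile
    fits.\<close>
  proof (cases "N < M \<or> N = 0")
    case True
    have "real (card Z) ^ N \<le> W ^ N" using W by (intro power_mono) auto
    also have "\<dots> \<le> W ^ (h + M)" using True W by (intro power_increasing) auto
    also have "\<dots> \<le> W ^ (h + M) * exp (b' * real N)" using W b(1) by simp
    finally show ?thesis by (rule spanned_mono[OF spanned_all[OF Z] subset_UNIV])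
  next
    case False
    have inv': "(\<theta> ^^ n) \<omega> \<in> \<Omega>" for n using less.prems inv by (induction n) auto
    have N: "M \<le> N" "0 < N" using False by auto
    \<comment> \<open>With h = 0 no hole may be spent; the empty set keeps the truncated
      \<open>h - 1\<close> from granting a free one.\<close>
    define hole where "hole = {x\<in>(UNIV :: 'x set). rds_iter \<theta> T 1 \<omega> x \<in> (if h = 0 then {} else S (N - 1) ((\<theta> ^^ 1) \<omega>) (h - 1))}"
    define tile where "tile n = {x\<in>Q n \<omega>. rds_iter \<theta> T n \<omega> x \<in> S (N - n) ((\<theta> ^^ n) \<omega>) h}" for n
    have cover: "S N \<omega> h \<subseteq> hole \<union> (\<Union>n\<in>{n0..M}. tile n)"
    proof
      fix x assume x: "x \<in> S N \<omega> h"
      show "x \<in> hole \<union> (\<Union>n\<in>{n0..M}. tile n)"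
      proof (cases "\<exists>n\<in>{n0..M}. x \<in> Q n \<omega>")
        case True
        then obtain n where n: "n \<in> {n0..M}" "x \<in> Q n \<omega>" by blast
        have "card (H (N - n) ((\<theta> ^^ n) \<omega>) (rds_iter \<theta> T n \<omega> x)) \<le> card (H N \<omega> x)"
          using shift[of n x] n N by (intro card_inj_on_le[of "(+) n"] fin) auto
        then have "x \<in> tile n" using x n by (simp add: tile_def S_def)
        then show ?thesis using n by blast
      next
        case False
        let ?H' = "(+) 1 ` H (N - 1) ((\<theta> ^^ 1) \<omega>) (rds_iter \<theta> T 1 \<omega> x)"
        have "0 \<in> H N \<omega> x" using False N by (auto simp: H_def)
        moreover have "0 \<notin> ?H'" by auto
        ultimately have "card ?H' < card (H N \<omega> x)"
          using shift[of 1 x] N by (intro psubset_card_mono fin) auto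
        then have "card (H (N - 1) ((\<theta> ^^ 1) \<omega>) (rds_iter \<theta> T 1 \<omega> x)) < card (H N \<omega> x)"
          by (subst (asm) card_image) auto
        then have "x \<in> hole" using x by (auto simp: hole_def S_def)
        then show ?thesis by blast
      qed
    qed
    \<comment> \<open>Each alternative for the start receives half of the bound: the hole because 2
      |Z| \<le> W, the tiles because the sum of exp (-(b' - b) n) over their lengths is at most 1/2.
      The loss from b to b' thus pays for the number of possible tilings.\<close>
    let ?c = "W ^ (h + M) * exp (b' * real N)"
    have "spanned \<theta> T \<eta> \<omega> N hole (1 / 2 * ?c)"
    proof (cases "h = 0")
      case True
      have "spanned \<theta> T \<eta> \<omega> N hole 0" unfolding spanned_def hole_def
        using True by (intro exI[of _ "{}"]) auto
      then show ?thesis by (rule spanned_mono) (use W in auto)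
    next
      case False
      have "spanned \<theta> T \<eta> \<omega> (1 + (N - 1)) hole (real (card Z) * (W ^ (h - 1 + M) * exp (b' * real (N - 1))))"
      proof -
        have "hole = {x\<in>(UNIV :: 'x set). rds_iter \<theta> T 1 \<omega> x \<in> S (N - 1) ((\<theta> ^^ 1) \<omega>) (h - 1)}"
          using False by (simp add: hole_def)
        moreover have "N - 1 < N" using N by simp
        ultimately show ?thesis
          using spanned_concat[OF spanned_one[OF Z, where S = UNIV] IH[OF _ inv'[of 1], of "N - 1" "h - 1"]] by simp
      qed
      moreover have "real (card Z) * (W ^ (h - 1 + M) * exp (b' * real (N - 1))) \<le> 1 / 2 * ?c"
      proof -
        have "b' * real (N - 1) \<le> b' * real N" using b(1) by (intro mult_left_mono) auto
        then have "real (card Z) * (W ^ (h - 1 + M) * exp (b' * real (N - 1)))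
            \<le> (W / 2) * (W ^ (h - 1 + M) * exp (b' * real N))"
          using W by (intro mult_mono) auto
        also have "\<dots> = 1 / 2 * (W ^ Suc (h - 1 + M) * exp (b' * real N))" by simp
        also have "Suc (h - 1 + M) = h + M" using False by simp
        finally show ?thesis .
      qed
      ultimately show ?thesis using N by (auto intro: spanned_mono)
    qed
    moreover have "spanned \<theta> T \<eta> \<omega> N (\<Union>n\<in>{n0..M}. tile n) (1 / 2 * ?c)"
    proof -
      have "spanned \<theta> T \<eta> \<omega> N (\<Union>n\<in>{n0..M}. tile n) (\<Sum>n=n0..M. exp (- (b' - b) * real n) * ?c)"
      proof (rule spanned_UN)
        fix n assume n: "n \<in> {n0..M}"
        then have le: "n \<le> N" "0 < n" using N n0 by auto
        have "spanned \<theta> T \<eta> \<omega> (n + (N - n)) (tile n) (exp (b * real n) * (W ^ (h + M) * exp (b' * real (N - n))))"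
          unfolding tile_def using n le less.prems inv'[of n] by (intro spanned_concat Q IH) auto
        also have "exp (b * real n) * (W ^ (h + M) * exp (b' * real (N - n))) = exp (- (b' - b) * real n) * ?c"
          using le by (simp add: exp_add[symmetric] of_nat_diff algebra_simps)
        finally show "spanned \<theta> T \<eta> \<omega> N (tile n) (exp (- (b' - b) * real n) * ?c)" using le by simp
      qed simp
      moreover have "(\<Sum>n=n0..M. exp (- (b' - b) * real n) * ?c) \<le> 1 / 2 * ?c"
        unfolding sum_distrib_right[symmetric] using b(2) W by (intro mult_right_mono) auto
      ultimately show ?thesis by (auto intro: spanned_mono)
    qed
    ultimately have "spanned \<theta> T \<eta> \<omega> N (hole \<union> (\<Union>n\<in>{n0..M}. tile n)) (1 / 2 * ?c + 1 / 2 * ?c)"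
      by (rule spanned_Un)
    then show ?thesis using cover by (rule spanned_mono) simp
  qed
  then show ?case by (simp add: S_def H_def)
qed

section \<open>Compact metric spaces\<close>

lemma compact_UNIV_net:
  assumes "compact (UNIV :: 'x :: metric_space set)" "e > 0"
  obtains Z where "finite Z" "\<And>x::'x. \<exists>z\<in>Z. dist x z < e"
proof -
  obtain Z where Z: "finite Z" "(UNIV :: 'x set) \<subseteq> (\<Union>z\<in>Z. ball z e)"
    using seq_compact_imp_totally_bounded[OF compact_imp_seq_compact[OF assms(1)]] assms(2) by metis
  show ?thesis
  proof (rule that[OF Z(1)])
    fix x :: 'x
    have "x \<in> (\<Union>z\<in>Z. ball z e)" using Z(2) by blast
    then show "\<exists>z\<in>Z. dist x z < e" by (auto simp: dist_commute)
  qed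
qed

lemma compact_UNIV_separable:
  assumes "compact (UNIV :: 'x :: metric_space set)"
  obtains D where "countable D" "\<And>(x::'x) e. e > 0 \<Longrightarrow> \<exists>d\<in>D. dist x d < e"
proof -
  have "\<exists>Z. finite Z \<and> (\<forall>x::'x. \<exists>z\<in>Z. dist x z < inverse (Suc n))" for n
  proof -
    have "0 < inverse (real (Suc n))" by simp
    from compact_UNIV_net[OF assms this] show ?thesis by metis
  qed
  then obtain Z where Z: "\<And>n. finite (Z n)" "\<And>n (x::'x). \<exists>z\<in>Z n. dist x z < inverse (Suc n)" by metis
  show ?thesis
  proof (rule that)
    show "countable (\<Union>n. Z n)" using Z(1) by (auto intro: countable_finite)
    fix x :: 'x and e :: real assume "e > 0"
    then obtain n where n: "inverse (Suc n) < e" using reals_Archimedean by blast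
    obtain z where "z \<in> Z n" "dist x z < inverse (Suc n)" using Z(2) by blast
    then show "\<exists>d\<in>\<Union>n. Z n. dist x d < e" using n by (intro bexI[of _ z]) auto
  qed
qed

text \<open>Finite intersections of balls with rational radii and centres in a countable dense set;
  the empty intersection gives \<open>UNIV\<close>. Countability lets an almost sure identity on
  each generator hold simultaneously, and intersection stability extends it to all Borel
  sets.\<close>

lemma compact_UNIV_borel_generator:
  assumes "compact (UNIV :: 'x :: metric_space set)"
  obtains G :: "'x :: metric_space set set" where "countable G" "Int_stable G" "UNIV \<in> G" "sets borel = sigma_sets UNIV G"
proof -
  obtain D where D: "countable D" "\<And>(x::'x) e. e > 0 \<Longrightarrow> \<exists>d\<in>D. dist x d < e"
    using compact_UNIV_separable[OF assms] by blast
  define B where "B = (\<lambda>(d, r). ball d r) ` (D \<times> (\<rat> :: real set))"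
  define G where "G = (\<lambda>F. \<Inter>F) ` {F. finite F \<and> F \<subseteq> B}"
  have "countable B" unfolding B_def using D(1) countable_rat by (intro countable_image countable_SIGMA) auto
  then have G: "countable G" unfolding G_def by (intro countable_image countable_Collect_finite_subset)
  have "topological_basis G"
  proof (rule topological_basisI)
    fix g assume "g \<in> G" then show "open g" by (auto simp: G_def B_def intro!: open_Inter)
  next
    fix O' and x :: 'x assume O': "open O'" "x \<in> O'"
    then obtain e where e: "e > 0" "ball x e \<subseteq> O'" using open_contains_ball by blast
    obtain r where r: "r \<in> \<rat>" "0 < r" "r < e / 2" using Rats_dense_in_real[of 0 "e / 2"] e(1) by auto
    obtain d where d: "d \<in> D" "dist x d < r" using D(2)[OF r(2)] by blast
    have "ball d r \<subseteq> O'"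
    proof
      fix y assume "y \<in> ball d r"
      then have "dist x y < e" using d(2) r(3) dist_triangle[of x y d] by (simp add: dist_commute)
      then show "y \<in> O'" using e(2) by auto
    qed
    moreover have "ball d r \<in> G"
      unfolding G_def B_def using d(1) r(1) by (intro image_eqI[of _ _ "{ball d r}"]) auto
    moreover have "x \<in> ball d r" using d(2) by (simp add: dist_commute)
    ultimately show "\<exists>B'\<in>G. x \<in> B' \<and> B' \<subseteq> O'" by (intro bexI[of _ "ball d r"] conjI)
  qed
  then have "borel = sigma UNIV G" using G by (intro borel_eq_countable_basis)
  then have "sets borel = sets (sigma UNIV G)" by simp
  also have "\<dots> = sigma_sets UNIV G" by (rule sets_measure_of) simp
  finally have sets: "sets borel = sigma_sets UNIV G" .
  have "Int_stable G"
  proof (rule Int_stableI)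
    fix a b assume "a \<in> G" "b \<in> G"
    then obtain F F' where "a = \<Inter>F" "b = \<Inter>F'" "finite F" "finite F'" "F \<subseteq> B" "F' \<subseteq> B"
      by (auto simp: G_def)
    then show "a \<inter> b \<in> G" unfolding G_def by (intro image_eqI[of _ _ "F \<union> F'"]) auto
  qed
  moreover have "UNIV \<in> G" unfolding G_def by (intro image_eqI[of _ _ "{}"]) auto
  ultimately show ?thesis using that G sets by blast
qed

text \<open>The library's measurability of \<open>dist\<close> is restricted to the class of second countable
  topological spaces, whereas here compactness is an assumption on the carrier.\<close>

lemma sets_Collect_dist_less:
  fixes f g :: "'a \<Rightarrow> 'x :: metric_space"
  assumes "compact (UNIV :: 'x set)" and f: "f \<in> measurable M borel" and g: "g \<in> measurable M borel"
  shows "{p\<in>space M. dist (f p) (g p) < e} \<in> sets M"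
proof -
  obtain D where D: "countable D" "\<And>(x::'x) e. e > 0 \<Longrightarrow> \<exists>d\<in>D. dist x d < e"
    using compact_UNIV_separable[OF assms(1)] by blast
  have ball: "{p\<in>space M. dist (h p) d < r} \<in> sets M" if "h \<in> measurable M borel" for h d r
  proof -
    have "h -` ball d r \<inter> space M \<in> sets M" using that by (rule measurable_sets) simp
    also have "h -` ball d r \<inter> space M = {p\<in>space M. dist (h p) d < r}" by (auto simp: dist_commute)
    finally show ?thesis .
  qed
  \<comment> \<open>Both points are compared with one point d of a dense set, with e split into
    rational r and e - r; this leaves countably many ball conditions on f and g separately.\<close>
  have "{p\<in>space M. dist (f p) (g p) < e} =
    {p\<in>space M. \<exists>d\<in>D. \<exists>r\<in>\<rat>. dist (f p) d < r \<and> dist (g p) d < e - r}" (is "_ = ?R")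
  proof (intro set_eqI iffI)
    fix p assume p: "p \<in> {p\<in>space M. dist (f p) (g p) < e}"
    define s where "s = e - dist (f p) (g p)"
    have "s > 0" using p by (simp add: s_def)
    then obtain r where r: "r \<in> \<rat>" "0 < r" "r < s / 2" using Rats_dense_in_real[of 0 "s / 2"] by auto
    obtain d where d: "d \<in> D" "dist (f p) d < r" using D(2)[OF r(2)] by blast
    have "dist (g p) d < e - r"
      using dist_triangle[of "g p" d "f p"] d(2) r(3) by (simp add: s_def dist_commute)
    then show "p \<in> ?R" using p d r by blast
  next
    fix p assume "p \<in> ?R"
    then obtain d r where "p \<in> space M" "dist (f p) d < r" "dist (g p) d < e - r" by blast
    then show "p \<in> {p\<in>space M. dist (f p) (g p) < e}" using dist_triangle2[of "f p" "g p" d] by auto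
  qed
  also have "\<dots> \<in> sets M"
    by (intro sets.sets_Collect_countable_Ex' D(1) countable_rat sets.sets_Collect_conj ball f g)
  finally show ?thesis .
qed

section \<open>The maximal ergodic inequality\<close>

lemma measurable_funpow:
  assumes "f \<in> measurable M M"
  shows "(f ^^ n) \<in> measurable M M"
  using assms by (induction n) (auto simp: measurable_ident intro: measurable_comp)

lemma distr_funpow:
  assumes f: "f \<in> measurable M M" and "distr M M f = M"
  shows "distr M M (f ^^ n) = M"
proof (induction n)
  case (Suc n)
  have "distr (distr M M (f ^^ n)) M f = distr M M (f \<circ> f ^^ n)"
    using f measurable_funpow[OF f] by (rule distr_distr)
  then show ?case using Suc assms(2) by (simp add: comp_def)
qed (simp add: id_def)

definition visits :: "('a \<Rightarrow> 'a) \<Rightarrow> 'a set \<Rightarrow> nat \<Rightarrow> 'a \<Rightarrow> nat" where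
  "visits f B n x = card {i. i < n \<and> (f ^^ i) x \<in> B}"

lemma visits_eq_sum: "real (visits f B n x) = (\<Sum>i<n. indicator B ((f ^^ i) x))"
proof -
  have "{i. i < n \<and> (f ^^ i) x \<in> B} = {i\<in>{..<n}. (f ^^ i) x \<in> B}" by auto
  then show ?thesis unfolding visits_def
    by (simp add: indicator_def sum.If_cases Int_def flip: of_bool_def)
qed

lemma visits_add: "visits f B (n + m) x = visits f B n x + visits f B m ((f ^^ n) x)"
proof -
  have "{i. i < n + m \<and> (f ^^ i) x \<in> B} =
      {i. i < n \<and> (f ^^ i) x \<in> B} \<union> (+) n ` {i. i < m \<and> (f ^^ i) ((f ^^ n) x) \<in> B}" (is "?A = ?L \<union> ?R")
  proof (intro set_eqI iffI)
    fix i assume i: "i \<in> ?A"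
    show "i \<in> ?L \<union> ?R"
    proof (cases "i < n")
      case False
      then obtain j where "i = n + j" by (metis le_add_diff_inverse linorder_not_less)
      then show ?thesis using i by (auto simp: funpow_add add.commute[of n])
    qed (use i in auto)
  qed (auto simp: funpow_add add.commute[of n])
  moreover have "card (?L \<union> ?R) = card ?L + card ?R" by (intro card_Un_disjoint) auto
  ultimately show ?thesis unfolding visits_def by (simp add: card_image)
qed

lemma visits_le: "visits f B n x \<le> n"
  unfolding visits_def using card_mono[of "{..<n}" "{i. i < n \<and> (f ^^ i) x \<in> B}"] by auto

lemma visits_one: "x \<notin> B \<Longrightarrow> visits f B 1 x = 0"
  by (auto simp: visits_def)

lemma visits_mono: "m \<le> n \<Longrightarrow> visits f B m x \<le> visits f B n x"
  unfolding visits_def by (intro card_mono) auto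

text \<open>Cover \<open>[0, R)\<close> by disjoint intervals starting at visits to \<open>E\<close>, each with many visits to \<open>B\<close>.\<close>

lemma visits_rising_set:
  assumes E: "\<And>x. x \<in> E \<Longrightarrow> \<exists>N\<le>N0. \<epsilon> * real N < real (visits f B N x)" and "\<epsilon> > 0"
  shows "\<epsilon> * real (visits f E R x) \<le> real (visits f B (R + N0) x)"
proof (induction R arbitrary: x rule: less_induct)
  case (less R)
  show ?case
  proof (cases "R = 0")
    case True
    then show ?thesis by (simp add: visits_def)
  next
    case False
    show ?thesis
    proof (cases "x \<in> E")
      case False
      have R: "R = 1 + (R - 1)" using \<open>R \<noteq> 0\<close> by simp
      have "\<epsilon> * real (visits f E R x) = \<epsilon> * real (visits f E (R - 1) ((f ^^ 1) x))"
        using visits_add[of f E 1 "R - 1" x] visits_one[OF False, of f] R by simp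
      also have "\<dots> \<le> real (visits f B (R - 1 + N0) ((f ^^ 1) x))" using R by (intro less.IH) simp
      also have "\<dots> \<le> real (visits f B (1 + (R - 1 + N0)) x)" unfolding visits_add[of f B 1] by simp
      also have "1 + (R - 1 + N0) = R + N0" using R by simp
      finally show ?thesis .
    next
      case True
      then obtain N where N: "N \<le> N0" "\<epsilon> * real N < real (visits f B N x)" using E by blast
      have "N \<noteq> 0" using N(2) by (intro notI) (simp add: visits_def)
      show ?thesis
      \<comment> \<open>The interval starting at x may overrun R, but by at most N0; the summand N0
        on the right absorbs this.\<close>
      proof (cases "R \<le> N")
        case True
        have "\<epsilon> * real (visits f E R x) \<le> \<epsilon> * real N"
          using visits_le[of f E R x] True assms(2) by (intro mult_left_mono) auto
        also have "\<dots> \<le> real (visits f B N x)" using N by simp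
        also have "\<dots> \<le> real (visits f B (R + N0) x)" using N by (simp add: visits_mono)
        finally show ?thesis .
      next
        case False
        then have R: "R = N + (R - N)" by simp
        have "\<epsilon> * real (visits f E R x) =
            \<epsilon> * real (visits f E N x) + \<epsilon> * real (visits f E (R - N) ((f ^^ N) x))"
          using visits_add[of f E N "R - N" x] R by (simp add: distrib_left)
        also have "\<dots> \<le> \<epsilon> * real N + real (visits f B (R - N + N0) ((f ^^ N) x))"
          using visits_le[of f E N x] assms(2) \<open>N \<noteq> 0\<close> False
          by (intro add_mono mult_left_mono less.IH) auto
        also have "\<dots> \<le> real (visits f B N x + visits f B (R - N + N0) ((f ^^ N) x))" using N by simp
        also have "\<dots> = real (visits f B (N + (R - N + N0)) x)" by (simp only: visits_add)
        also have "N + (R - N + N0) = R + N0" using False by simp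
        finally show ?thesis .
      qed
    qed
  qed
qed

lemma measurable_visits:
  assumes "f \<in> measurable M M" "B \<in> sets M"
  shows "(\<lambda>x. real (visits f B n x)) \<in> borel_measurable M"
  unfolding visits_eq_sum using assms
  by (intro borel_measurable_sum measurable_compose[OF measurable_funpow borel_measurable_indicator])

lemma (in prob_space) integral_visits:
  assumes f: "f \<in> measurable M M" and pres: "distr M M f = M" and B: "B \<in> sets M"
  shows "integrable M (\<lambda>x. real (visits f B n x))" "(\<integral>x. real (visits f B n x) \<partial>M) = real n * measure M B"
proof -
  have int: "integrable M (\<lambda>x. indicator B ((f ^^ i) x) :: real)" for i
    using measurable_compose[OF measurable_funpow[OF f] borel_measurable_indicator[OF B], of i]
    by (intro integrable_const_bound[of _ 1]) (auto simp: indicator_def)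
  have eq: "(\<integral>x. (indicator B ((f ^^ i) x) :: real) \<partial>M) = measure M B" for i
  proof -
    have "(\<integral>x. (indicator B ((f ^^ i) x) :: real) \<partial>M) = (\<integral>x. indicator B x \<partial>distr M M (f ^^ i))"
      by (rule integral_distr[OF measurable_funpow[OF f] borel_measurable_indicator[OF B], symmetric])
    also have "\<dots> = measure M B" unfolding distr_funpow[OF f pres] using B by simp
    finally show ?thesis .
  qed
  show "integrable M (\<lambda>x. real (visits f B n x))" unfolding visits_eq_sum by (intro Bochner_Integration.integrable_sum int)
  show "(\<integral>x. real (visits f B n x) \<partial>M) = real n * measure M B"
    unfolding visits_eq_sum by (subst Bochner_Integration.integral_sum) (auto simp: int eq)
qed

text \<open>Integrating the covering estimate over the points whose witness N is at most N0 gives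
  \<epsilon> R \<mu>(E) \<le> (R + N0) \<mu>(B). Dividing by R and letting R tend to infinity
  removes N0 from the bound, so N0 can then grow. The value N = 0 never witnesses the strict
  inequality.\<close>

lemma (in prob_space) maximal_ergodic_inequality:
  assumes f: "f \<in> measurable M M" and pres: "distr M M f = M" and B: "B \<in> sets M" and "\<epsilon> > 0"
  shows "{x\<in>space M. \<exists>N. \<epsilon> * real N < real (visits f B N x)} \<in> sets M" (is "?V \<in> _")
    and "measure M {x\<in>space M. \<exists>N. \<epsilon> * real N < real (visits f B N x)} \<le> measure M B / \<epsilon>"
proof -
  define E where "E N0 = {x\<in>space M. \<exists>N\<le>N0. \<epsilon> * real N < real (visits f B N x)}" for N0
  have 1: "{x\<in>space M. \<epsilon> * real N < real (visits f B N x)} \<in> sets M" for N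
    using measurable_visits[OF f B] by measurable
  have E: "E N0 \<in> sets M" for N0
  proof -
    have "E N0 = {x\<in>space M. \<exists>N\<in>{..N0}. \<epsilon> * real N < real (visits f B N x)}" by (auto simp: E_def)
    also have "\<dots> \<in> sets M" by (intro sets.sets_Collect_finite_Ex 1) auto
    finally show ?thesis .
  qed
  show V: "?V \<in> sets M" by (intro sets.sets_Collect_countable_Ex 1)
  have bound: "measure M (E N0) \<le> measure M B / \<epsilon>" for N0
  proof -
    have R: "\<epsilon> * (real R * measure M (E N0)) \<le> real (R + N0) * measure M B" for R
    proof -
      have "\<epsilon> * (real R * measure M (E N0)) = (\<integral>x. \<epsilon> * real (visits f (E N0) R x) \<partial>M)"
        by (simp add: integral_visits[OF f pres E])
      also have "\<dots> \<le> (\<integral>x. real (visits f B (R + N0) x) \<partial>M)"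
      proof (rule integral_mono)
        show "\<epsilon> * real (visits f (E N0) R x) \<le> real (visits f B (R + N0) x)" for x
          by (rule visits_rising_set) (auto simp: E_def assms(4))
      qed (auto simp: integral_visits[OF f pres E] integral_visits[OF f pres B])
      also have "\<dots> = real (R + N0) * measure M B" by (rule integral_visits[OF f pres B])
      finally show ?thesis .
    qed
    have "(\<lambda>R. (1 + real N0 / real (Suc R)) * measure M B) \<longlonglongrightarrow> (1 + 0) * measure M B"
      by (intro tendsto_intros LIMSEQ_Suc lim_const_over_n)
    moreover have "\<epsilon> * measure M (E N0) \<le> (1 + real N0 / real (Suc R)) * measure M B" for R
      using R[of "Suc R"] by (simp add: field_simps)
    ultimately have "\<epsilon> * measure M (E N0) \<le> (1 + 0) * measure M B"
      by (intro LIMSEQ_le_const) auto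
    then show ?thesis using assms(4) by (simp add: field_simps)
  qed
  have "incseq E" by (intro incseq_SucI) (auto simp: E_def intro: le_SucI)
  then have "(\<lambda>N0. measure M (E N0)) \<longlonglongrightarrow> measure M (\<Union>N0. E N0)"
    using E by (intro finite_Lim_measure_incseq) auto
  moreover have "(\<Union>N0. E N0) = ?V" by (auto simp: E_def)
  ultimately show "measure M ?V \<le> measure M B / \<epsilon>" using bound by (intro LIMSEQ_le_const2) auto
qed

section \<open>Packing and covering with measurable sets\<close>

text \<open>Disjoint sets of mass at least \<beta> number at most 1 / \<beta>, so a disjoint
  subfamily of greatest cardinality exists, and no further set can be added to it.\<close>

lemma (in prob_space) maximal_disjoint_subfamily:
  assumes F: "\<And>x. x \<in> S \<Longrightarrow> F x \<in> sets M" "\<And>x. x \<in> S \<Longrightarrow> \<beta> \<le> measure M (F x)" and "\<beta> > 0"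
  shows "\<exists>E. E \<subseteq> S \<and> finite E \<and> real (card E) * \<beta> \<le> 1 \<and> (\<forall>x\<in>S. \<exists>e\<in>E. F e \<inter> F x \<noteq> {})"
proof -
  define P where "P E \<longleftrightarrow> E \<subseteq> S \<and> finite E \<and> disjoint_family_on F E" for E
  have card: "real (card E) * \<beta> \<le> 1" if "P E" for E
  proof -
    have "real (card E) * \<beta> = (\<Sum>e\<in>E. \<beta>)" by simp
    also have "\<dots> \<le> (\<Sum>e\<in>E. measure M (F e))" using that F by (intro sum_mono) (auto simp: P_def)
    also have "\<dots> = measure M (\<Union>e\<in>E. F e)"
      using that F by (intro finite_measure_finite_Union[symmetric]) (auto simp: P_def)
    also have "\<dots> \<le> 1" by simp
    finally show ?thesis .
  qed
  have "\<exists>E. P E \<and> (\<forall>E'. P E' \<longrightarrow> card E' \<le> card E)"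
  proof (rule ex_has_greatest_nat)
    show "P {}" by (simp add: P_def disjoint_family_on_def)
    show "\<forall>E. P E \<longrightarrow> card E < Suc (nat \<lfloor>1 / \<beta>\<rfloor>)"
      using card assms(3) by (auto simp: le_nat_floor field_simps less_Suc_eq_le)
  qed
  then obtain E where E: "P E" "\<And>E'. P E' \<Longrightarrow> card E' \<le> card E" by blast
  show ?thesis
  proof (intro exI[of _ E] conjI)
    have "\<exists>e\<in>E. F e \<inter> F x \<noteq> {}" if x: "x \<in> S" for x
    proof (rule ccontr)
      assume neg: "\<not> (\<exists>e\<in>E. F e \<inter> F x \<noteq> {})"
      \<comment> \<open>Positive mass makes F x meet itself, so an x meeting no chosen set is
        genuinely new.\<close>
      have "F x \<noteq> {}" using F(2)[OF x] assms(3) by auto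
      then have "x \<notin> E" using neg by auto
      moreover have "P (insert x E)" using E(1) x neg by (auto simp: P_def disjoint_family_on_def)
      then have "card (insert x E) \<le> card E" by (rule E(2))
      ultimately show False using E(1) by (simp add: P_def)
    qed
    then show "\<forall>x\<in>S. \<exists>e\<in>E. F e \<inter> F x \<noteq> {}" by blast
  qed (use E(1) card[OF E(1)] in \<open>auto simp: P_def\<close>)
qed

text \<open>A covering set that meets S lies in the Bowen ball around any of its points in S, and
  that ball has mass at most \<beta>.\<close>

lemma measure_le_of_spanned:
  fixes M :: "'x :: metric_space measure"
  assumes "prob_space M" and span: "spanned \<theta> T \<eta> \<omega> n S k" and n: "0 < n" and \<beta>: "0 \<le> \<beta>"
    and ball: "\<And>x. x \<in> S \<Longrightarrow> bowen_ball \<theta> T n \<omega> x \<eta> \<in> sets M"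
      "\<And>x. x \<in> S \<Longrightarrow> measure M (bowen_ball \<theta> T n \<omega> x \<eta>) \<le> \<beta>"
  shows "measure M S \<le> k * \<beta>"
proof -
  interpret prob_space M by fact
  obtain \<C> where \<C>: "finite \<C>" "real (card \<C>) \<le> k" "S \<subseteq> \<Union>\<C>"
    "\<forall>C\<in>\<C>. \<forall>y\<in>C. \<forall>z\<in>C. \<forall>i<n. dist (rds_iter \<theta> T i \<omega> y) (rds_iter \<theta> T i \<omega> z) < \<eta>"
    using span unfolding spanned_def by (elim exE conjE)
  define \<D> where "\<D> = {C\<in>\<C>. C \<inter> S \<noteq> {}}"
  have "\<forall>C\<in>\<D>. \<exists>x. x \<in> C \<inter> S" by (auto simp: \<D>_def)
  then obtain p where p: "\<And>C. C \<in> \<D> \<Longrightarrow> p C \<in> C \<inter> S" by metis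
  have sub: "S \<subseteq> (\<Union>C\<in>\<D>. bowen_ball \<theta> T n \<omega> (p C) \<eta>)"
  proof
    fix x assume x: "x \<in> S"
    then obtain C where C: "C \<in> \<C>" "x \<in> C" using \<C>(3) by blast
    then have "C \<in> \<D>" using x by (auto simp: \<D>_def)
    then show "x \<in> (\<Union>C\<in>\<D>. bowen_ball \<theta> T n \<omega> (p C) \<eta>)"
      using p \<C>(4) C by (auto simp: bowen_ball_eq[OF n] intro!: bexI[of _ C])
  qed
  have fin: "finite \<D>" using \<C>(1) by (simp add: \<D>_def)
  have sets: "(\<lambda>C. bowen_ball \<theta> T n \<omega> (p C) \<eta>) ` \<D> \<subseteq> sets M" using p ball(1) by blast
  \<comment> \<open>Monotonicity asks only for measurability of the larger set; a nonmeasurable S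
    has measure 0 by convention.\<close>
  have "measure M S \<le> measure M (\<Union>C\<in>\<D>. bowen_ball \<theta> T n \<omega> (p C) \<eta>)"
    using sub fin sets by (intro finite_measure_mono sets.finite_UN) auto
  also have "\<dots> \<le> (\<Sum>C\<in>\<D>. measure M (bowen_ball \<theta> T n \<omega> (p C) \<eta>))"
    using fin sets by (rule finite_measure_subadditive_finite)
  also have "\<dots> \<le> (\<Sum>C\<in>\<D>. \<beta>)" using p ball(2) by (intro sum_mono) blast
  also have "\<dots> = real (card \<D>) * \<beta>" by simp
  also have "\<dots> \<le> k * \<beta>"
  proof -
    have "card \<D> \<le> card \<C>" using \<C>(1) by (intro card_mono) (auto simp: \<D>_def)
    then show ?thesis using \<C>(2) \<beta> by (intro mult_right_mono) auto
  qed
  finally show ?thesis .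
qed

text \<open>Ball decay rates grow as the radius shrinks, so each limit as \<delta> tends to 0 is a
  supremum; limits are thereafter compared as suprema.\<close>

lemma tendsto_SUP_at_right_0:
  fixes f :: "real \<Rightarrow> 'a :: {complete_linorder, linorder_topology}"
  assumes "\<And>a b. 0 < a \<Longrightarrow> a \<le> b \<Longrightarrow> f b \<le> f a"
  shows "(f \<longlongrightarrow> (SUP a\<in>{0<..}. f a)) (at_right 0)"
proof (rule order_tendstoI)
  fix l assume "l < (SUP a\<in>{0<..}. f a)"
  then obtain a where a: "a > 0" "l < f a" by (auto simp: less_SUP_iff)
  have "\<forall>\<^sub>F b in at_right 0. b \<in> {0<..<a}" using a(1) by (rule eventually_at_right_real)
  then show "\<forall>\<^sub>F b in at_right 0. l < f b"
    by eventually_elim (use a assms in \<open>auto intro: less_le_trans\<close>)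
next
  fix u assume u: "(SUP a\<in>{0<..}. f a) < u"
  have "\<forall>\<^sub>F b in at_right 0. (0 :: real) < b" by (rule eventually_at_right_less)
  then show "\<forall>\<^sub>F b in at_right 0. f b < u"
  proof eventually_elim
    case (elim b)
    then have "f b \<le> (SUP a\<in>{0<..}. f a)" by (intro SUP_upper) auto
    then show ?case using u by (rule le_less_trans)
  qed
qed

section \<open>Invariant measures of the skew product\<close>

locale disintegrated_rds = continuous_bundle_rds P \<theta> T
  for P :: "'w measure" and \<theta> and T :: "'w \<Rightarrow> 'x \<Rightarrow> 'x :: metric_space" +
  fixes \<mu> :: "('w \<times> 'x) measure" and \<kappa> :: "'w \<Rightarrow> 'x measure"
  assumes compact_UNIV: "compact (UNIV :: 'x set)"
    and invariant: "\<mu> \<in> invariant_measures P \<theta> T"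
    and disintegration: "is_disintegration P \<mu> \<kappa>"
begin

abbreviation "\<Theta> \<equiv> skew_product \<theta> T"

lemma sets_\<mu>: "sets \<mu> = sets (P \<Otimes>\<^sub>M borel)"
  and prob_\<mu>: "prob_space \<mu>"
  and distr_skew: "distr \<mu> \<mu> \<Theta> = \<mu>"
  and distr_fst: "distr \<mu> P fst = P"
  using invariant by (auto simp: invariant_measures_def)

sublocale \<mu>: prob_space \<mu> by (rule prob_\<mu>)

lemma space_\<mu>: "space \<mu> = space P \<times> UNIV"
  using sets_eq_imp_space_eq[OF sets_\<mu>] by (simp add: space_pair_measure)

lemma measurable_\<mu>_iff: "measurable \<mu> N = measurable (P \<Otimes>\<^sub>M borel) N"
  by (intro measurable_cong_sets sets_\<mu>) simp

lemma measurable_fst_\<mu>: "fst \<in> measurable \<mu> P"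
  by (simp add: measurable_\<mu>_iff)

lemma measurable_skew: "\<Theta> \<in> measurable \<mu> \<mu>"
proof -
  have "(\<lambda>p. (\<theta> (fst p), (\<lambda>(\<omega>, x). T \<omega> x) p)) \<in> measurable (P \<Otimes>\<^sub>M borel) (P \<Otimes>\<^sub>M borel)"
    by (intro measurable_Pair measurable_compose[OF measurable_fst measurable_\<theta>] measurable_T)
  also have "(\<lambda>p. (\<theta> (fst p), (\<lambda>(\<omega>, x). T \<omega> x) p)) = \<Theta>"
    by (auto simp: skew_product_def)
  finally show ?thesis using measurable_cong_sets[OF sets_\<mu> sets_\<mu>] by blast
qed

lemma \<theta>_space: "\<omega> \<in> space P \<Longrightarrow> \<theta> \<omega> \<in> space P"
  using measurable_\<theta> by (rule measurable_space)

lemma measurable_iter: "(\<lambda>p. rds_iter \<theta> T n (fst p) (snd p)) \<in> borel_measurable (P \<Otimes>\<^sub>M borel)"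
proof -
  have "(\<lambda>p. snd ((\<Theta> ^^ n) p)) \<in> borel_measurable (P \<Otimes>\<^sub>M borel)"
    using measurable_compose[OF measurable_funpow[OF measurable_skew] , of snd borel n]
    by (simp add: measurable_\<mu>_iff)
  also have "(\<lambda>p. snd ((\<Theta> ^^ n) p)) = (\<lambda>p. rds_iter \<theta> T n (fst p) (snd p))"
    by (auto simp: skew_product_funpow)
  finally show ?thesis .
qed

lemma kernel: "\<omega> \<in> space P \<Longrightarrow> prob_space (\<kappa> \<omega>)" "\<omega> \<in> space P \<Longrightarrow> sets (\<kappa> \<omega>) = sets borel"
  and measurable_\<kappa>: "\<kappa> \<in> measurable P (prob_algebra borel)"
proof -
  show \<kappa>: "\<kappa> \<in> measurable P (prob_algebra borel)" using disintegration by (simp add: is_disintegration_def)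
  show "\<omega> \<in> space P \<Longrightarrow> prob_space (\<kappa> \<omega>)" "\<omega> \<in> space P \<Longrightarrow> sets (\<kappa> \<omega>) = sets borel"
    using measurable_space[OF \<kappa>] by (auto simp: space_prob_algebra)
qed

lemma emeasure_\<mu>:
  "A \<in> sets \<mu> \<Longrightarrow> emeasure \<mu> A = (\<integral>\<^sup>+\<omega>. emeasure (\<kappa> \<omega>) {x. (\<omega>, x) \<in> A} \<partial>P)"
  using disintegration by (simp add: is_disintegration_def sets_\<mu>)

text \<open>Since \<open>\<theta>\<close> is invertible, invariance of \<open>\<mu>\<close> passes to the disintegration, by its uniqueness.\<close>

lemma AE_kernel_equivariant: "AE \<omega> in P. \<forall>C\<in>sets borel. emeasure (\<kappa> \<omega>) (T \<omega> -` C) = emeasure (\<kappa> (\<theta> \<omega>)) C"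
proof -
  have T: "T \<omega> \<in> borel_measurable borel" if "\<omega> \<in> space P" for \<omega>
    using measurable_Pair2[OF measurable_T that] by simp
  \<comment> \<open>For fixed C both sides are densities with respect to P, so it suffices to
    compare their integrals over every B.\<close>
  have ae: "AE \<omega> in P. emeasure (\<kappa> \<omega>) (T \<omega> -` C) = emeasure (\<kappa> (\<theta> \<omega>)) C" if C: "C \<in> sets borel" for C
  proof (rule density_unique_finite_measure)
    define D where "D = (\<lambda>(\<omega>, x). T \<omega> x) -` C \<inter> space (P \<Otimes>\<^sub>M borel)"
    have D: "D \<in> sets (P \<Otimes>\<^sub>M borel)" unfolding D_def using measurable_T C by (rule measurable_sets)
    have "(\<lambda>\<omega>. emeasure (\<kappa> \<omega>) (T \<omega> -` C)) \<in> borel_measurable P \<longleftrightarrow>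
        (\<lambda>\<omega>. emeasure (\<kappa> \<omega>) {x. (\<omega>, x) \<in> D}) \<in> borel_measurable P"
      by (intro measurable_cong arg_cong2[of _ _ _ _ emeasure]) (auto simp: D_def space_pair_measure)
    also have "\<dots>"
    proof (rule emeasure_measurable_subprob_algebra2)
      have "(SIGMA \<omega>:space P. {x. (\<omega>, x) \<in> D}) = D" by (auto simp: D_def space_pair_measure)
      then show "(SIGMA \<omega>:space P. {x. (\<omega>, x) \<in> D}) \<in> sets (P \<Otimes>\<^sub>M borel)" using D by simp
    qed (rule measurable_prob_algebraD[OF measurable_\<kappa>])
    finally show "(\<lambda>\<omega>. emeasure (\<kappa> \<omega>) (T \<omega> -` C)) \<in> borel_measurable P" .
    have \<kappa>C: "(\<lambda>\<omega>. emeasure (\<kappa> \<omega>) C) \<in> borel_measurable P"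
      using measurable_prob_algebraD[OF measurable_\<kappa>] C by (intro measurable_emeasure_kernel)
    then show "(\<lambda>\<omega>. emeasure (\<kappa> (\<theta> \<omega>)) C) \<in> borel_measurable P"
      by (rule measurable_compose[OF measurable_\<theta>])
    fix B assume B: "B \<in> sets P"
    \<comment> \<open>This is \<theta>(B), written as a preimage under the inverse to obtain
      measurability. Bijectivity makes \<theta> \<omega> \<in> B' equivalent to \<omega> \<in> B, so
      the integrals can be localised to B.\<close>
    define B' where "B' = inv_into (space P) \<theta> -` B \<inter> space P"
    have B': "B' \<in> sets P" unfolding B'_def using measurable_inv_\<theta> B by (rule measurable_sets)
    have mem: "\<theta> \<omega> \<in> B' \<longleftrightarrow> \<omega> \<in> B" if "\<omega> \<in> space P" for \<omega>
      using that bij_\<theta> \<theta>_space by (auto simp: B'_def bij_betw_def)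
    let ?A = "D \<inter> (B \<times> UNIV)"
    have A: "?A \<in> sets \<mu>" "B' \<times> C \<in> sets \<mu>" using B B' C D by (auto simp: sets_\<mu>)
    have "(\<integral>\<^sup>+\<omega>. emeasure (\<kappa> \<omega>) (T \<omega> -` C) * indicator B \<omega> \<partial>P) = emeasure \<mu> ?A"
      unfolding emeasure_\<mu>[OF A(1)]
      by (intro nn_integral_cong) (auto simp: D_def space_pair_measure indicator_def vimage_def)
    also have "\<dots> = emeasure (distr \<mu> \<mu> \<Theta>) (B' \<times> C)"
    proof -
      have "\<Theta> -` (B' \<times> C) \<inter> space \<mu> = ?A"
        using mem by (auto simp: skew_product_def D_def space_pair_measure space_\<mu> dest: sets.sets_into_space[OF B, THEN subsetD])
      then show ?thesis using A(2) by (simp add: emeasure_distr[OF measurable_skew])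
    qed
    also have "\<dots> = (\<integral>\<^sup>+\<omega>. emeasure (\<kappa> \<omega>) C * indicator B' \<omega> \<partial>P)"
      unfolding distr_skew emeasure_\<mu>[OF A(2)] by (intro nn_integral_cong) (auto simp: indicator_def)
    also have "\<dots> = (\<integral>\<^sup>+\<omega>. emeasure (\<kappa> \<omega>) C * indicator B' \<omega> \<partial>distr P P \<theta>)" by (simp add: preserving_\<theta>)
    also have "\<dots> = (\<integral>\<^sup>+\<omega>. emeasure (\<kappa> (\<theta> \<omega>)) C * indicator B' (\<theta> \<omega>) \<partial>P)"
      by (intro nn_integral_distr measurable_\<theta>)
        (auto intro!: borel_measurable_times_ennreal \<kappa>C borel_measurable_indicator B')
    also have "\<dots> = (\<integral>\<^sup>+\<omega>. emeasure (\<kappa> (\<theta> \<omega>)) C * indicator B \<omega> \<partial>P)"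
      by (intro nn_integral_cong) (auto simp: indicator_def mem)
    finally show "(\<integral>\<^sup>+\<omega>. emeasure (\<kappa> \<omega>) (T \<omega> -` C) * indicator B \<omega> \<partial>P) =
        (\<integral>\<^sup>+\<omega>. emeasure (\<kappa> (\<theta> \<omega>)) C * indicator B \<omega> \<partial>P)" .
  qed auto
  obtain G :: "'x set set" where G: "countable G" "Int_stable G" "UNIV \<in> G" "sets borel = sigma_sets UNIV G"
    using compact_UNIV_borel_generator[OF compact_UNIV] by blast
  have "AE \<omega> in P. \<forall>C\<in>G. emeasure (\<kappa> \<omega>) (T \<omega> -` C) = emeasure (\<kappa> (\<theta> \<omega>)) C"
    using ae G(4) by (subst AE_ball_countable[OF G(1)]) auto
  with AE_space[of P] show ?thesis
  proof eventually_elim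
    case (elim \<omega>)
    have T\<omega>: "T \<omega> \<in> measurable (\<kappa> \<omega>) borel"
      using T[OF elim(1)] measurable_cong_sets[OF kernel(2)[OF elim(1)] refl] by blast
    have space: "space (\<kappa> \<omega>) = UNIV" using sets_eq_imp_space_eq[OF kernel(2)[OF elim(1)]] by simp
    have distr: "emeasure (distr (\<kappa> \<omega>) borel (T \<omega>)) C = emeasure (\<kappa> \<omega>) (T \<omega> -` C)" if "C \<in> sets borel" for C
      using emeasure_distr[OF T\<omega> that] by (simp add: space)
    have "distr (\<kappa> \<omega>) borel (T \<omega>) = \<kappa> (\<theta> \<omega>)"
    proof (rule measure_eqI_generator_eq[OF G(2), of UNIV _ _ "\<lambda>_. UNIV"])
      show "emeasure (distr (\<kappa> \<omega>) borel (T \<omega>)) X = emeasure (\<kappa> (\<theta> \<omega>)) X" if "X \<in> G" for X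
        using distr[of X] elim(2) that G(4) by auto
      show "sets (\<kappa> (\<theta> \<omega>)) = sigma_sets UNIV G" using kernel(2)[OF \<theta>_space[OF elim(1)]] G(4) by simp
      show "emeasure (distr (\<kappa> \<omega>) borel (T \<omega>)) UNIV \<noteq> \<infinity>" for i :: nat
        using prob_space.emeasure_le_1[OF kernel(1)[OF elim(1)], of UNIV] distr[of UNIV] by (auto simp: top_unique)
    qed (use G in auto)
    then show ?case using distr by metis
  qed
qed

section \<open>Joint and fibrewise measurability of the balls\<close>

lemma sets_Collect_match_ball:
  "{q\<in>space ((P \<Otimes>\<^sub>M borel) \<Otimes>\<^sub>M borel). snd q \<in> match_ball \<theta> T n (fst (fst q)) (snd (fst q)) \<epsilon>}
     \<in> sets ((P \<Otimes>\<^sub>M borel) \<Otimes>\<^sub>M borel)" (is "?S \<in> sets ?N")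
proof -
  \<comment> \<open>Fixing \<pi> outside D through \<open>PiE\<close> leaves finitely many pairs (D,
    \<pi>), so the ball becomes a finite union of finite intersections of distance
    conditions.\<close>
  have eq: "match_ball \<theta> T n \<omega> x \<epsilon> =
    {y. \<exists>D\<in>{D\<in>Pow {..<n}. (1 - \<epsilon>) * real n < real (card D)}. \<exists>\<pi>\<in>{\<pi>\<in>PiE D (\<lambda>_. {..<n}). strict_mono_on D \<pi>}.
      \<forall>i\<in>D. dist (rds_iter \<theta> T i \<omega> x) (rds_iter \<theta> T (\<pi> i) \<omega> y) < \<epsilon>}" (is "_ = ?R") for \<omega> x
  proof (intro set_eqI iffI)
    fix y assume "y \<in> match_ball \<theta> T n \<omega> x \<epsilon>"
    then obtain D \<pi> where "is_match \<theta> T \<omega> n \<epsilon> x y D \<pi>" "(1 - \<epsilon>) * real n < real (card D)"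
      by (auto simp: match_ball_def)
    then show "y \<in> ?R"
      by (intro CollectI bexI[of _ D] bexI[of _ "restrict \<pi> D"])
        (auto simp: is_match_def strict_mono_on_def image_subset_iff)
  next
    fix y assume "y \<in> ?R"
    then obtain D \<pi> where "D \<subseteq> {..<n}" "(1 - \<epsilon>) * real n < real (card D)" "\<pi> \<in> PiE D (\<lambda>_. {..<n})"
      "strict_mono_on D \<pi>" "\<forall>i\<in>D. dist (rds_iter \<theta> T i \<omega> x) (rds_iter \<theta> T (\<pi> i) \<omega> y) < \<epsilon>" by auto
    then show "y \<in> match_ball \<theta> T n \<omega> x \<epsilon>"
      by (auto simp: match_ball_def is_match_def PiE_iff image_subset_iff intro!: exI[of _ D] exI[of _ \<pi>])
  qed
  have 1: "{q\<in>space ?N. dist (rds_iter \<theta> T i (fst (fst q)) (snd (fst q))) (rds_iter \<theta> T j (fst (fst q)) (snd q)) < \<epsilon>}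
      \<in> sets ?N" for i j
  proof (rule sets_Collect_dist_less[OF compact_UNIV])
    show "(\<lambda>q. rds_iter \<theta> T i (fst (fst q)) (snd (fst q))) \<in> borel_measurable ?N"
      by (rule measurable_compose[OF measurable_fst measurable_iter])
    have "(\<lambda>q. (fst (fst q), snd q)) \<in> measurable ?N (P \<Otimes>\<^sub>M borel)" by measurable
    from measurable_compose[OF this measurable_iter]
    show "(\<lambda>q. rds_iter \<theta> T j (fst (fst q)) (snd q)) \<in> borel_measurable ?N" by simp
  qed
  have "finite {\<pi>\<in>PiE D (\<lambda>_. {..<n}). strict_mono_on D \<pi>}" if "D \<subseteq> {..<n}" for D
    by (rule finite_subset[of _ "PiE D (\<lambda>_. {..<n})"])
      (auto intro!: finite_PiE finite_subset[OF that])
  then show ?thesis unfolding eq mem_Collect_eq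
    by (intro sets.sets_Collect_finite_Ex sets.sets_Collect_finite_All 1)
      (auto intro: finite_subset[of _ "{..<n}"])
qed

lemma sets_Collect_bowen_ball:
  assumes "n > 0"
  shows "{q\<in>space ((P \<Otimes>\<^sub>M borel) \<Otimes>\<^sub>M borel). snd q \<in> bowen_ball \<theta> T n (fst (fst q)) (snd (fst q)) \<epsilon>}
     \<in> sets ((P \<Otimes>\<^sub>M borel) \<Otimes>\<^sub>M borel)" (is "?S \<in> sets ?N")
proof -
  have 1: "{q\<in>space ?N. dist (rds_iter \<theta> T i (fst (fst q)) (snd (fst q))) (rds_iter \<theta> T i (fst (fst q)) (snd q)) < \<epsilon>}
      \<in> sets ?N" for i
  proof (rule sets_Collect_dist_less[OF compact_UNIV])
    show "(\<lambda>q. rds_iter \<theta> T i (fst (fst q)) (snd (fst q))) \<in> borel_measurable ?N"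
      by (rule measurable_compose[OF measurable_fst measurable_iter])
    have "(\<lambda>q. (fst (fst q), snd q)) \<in> measurable ?N (P \<Otimes>\<^sub>M borel)" by measurable
    from measurable_compose[OF this measurable_iter]
    show "(\<lambda>q. rds_iter \<theta> T i (fst (fst q)) (snd q)) \<in> borel_measurable ?N" by simp
  qed
  have "?S = {q\<in>space ?N. \<forall>i\<in>{..<n}. dist (rds_iter \<theta> T i (fst (fst q)) (snd (fst q))) (rds_iter \<theta> T i (fst (fst q)) (snd q)) < \<epsilon>}"
    by (auto simp: bowen_ball_eq[OF assms])
  also have "\<dots> \<in> sets ?N" by (intro sets.sets_Collect_finite_All 1) auto
  finally show ?thesis .
qed

lemma sets_section:
  fixes A :: "'w \<Rightarrow> 'x \<Rightarrow> 'x set"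
  assumes "{q\<in>space ((P \<Otimes>\<^sub>M borel) \<Otimes>\<^sub>M borel). snd q \<in> A (fst (fst q)) (snd (fst q))} \<in> sets ((P \<Otimes>\<^sub>M borel) \<Otimes>\<^sub>M borel)"
    and "\<omega> \<in> space P"
  shows "A \<omega> x \<in> sets (\<kappa> \<omega>)"
proof -
  have "Pair (\<omega>, x) -` {q\<in>space ((P \<Otimes>\<^sub>M borel) \<Otimes>\<^sub>M borel). snd q \<in> A (fst (fst q)) (snd (fst q))} \<in> sets borel"
    using assms(1) by (rule sets_Pair1)
  then show ?thesis using assms(2) by (simp add: vimage_def space_pair_measure kernel(2))
qed

lemma measurable_kernel_section:
  fixes A :: "'w \<Rightarrow> 'x \<Rightarrow> 'x set"
  assumes "{q\<in>space ((P \<Otimes>\<^sub>M borel) \<Otimes>\<^sub>M borel). snd q \<in> A (fst (fst q)) (snd (fst q))} \<in> sets ((P \<Otimes>\<^sub>M borel) \<Otimes>\<^sub>M borel)"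
  shows "(\<lambda>p. measure (\<kappa> (fst p)) (A (fst p) (snd p))) \<in> borel_measurable \<mu>"
  unfolding measurable_\<mu>_iff
proof (rule measure_measurable_prob_algebra2)
  have "(SIGMA p:space (P \<Otimes>\<^sub>M borel). A (fst p) (snd p)) =
      {q\<in>space ((P \<Otimes>\<^sub>M borel) \<Otimes>\<^sub>M borel). snd q \<in> A (fst (fst q)) (snd (fst q))}"
    by (auto simp: space_pair_measure)
  then show "(SIGMA p:space (P \<Otimes>\<^sub>M borel). A (fst p) (snd p)) \<in> sets ((P \<Otimes>\<^sub>M borel) \<Otimes>\<^sub>M borel)"
    using assms by simp
qed (rule measurable_compose[OF measurable_fst measurable_\<kappa>])

lemma sets_match_ball: "\<omega> \<in> space P \<Longrightarrow> match_ball \<theta> T n \<omega> x \<epsilon> \<in> sets (\<kappa> \<omega>)"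
  by (rule sets_section[OF sets_Collect_match_ball])

lemma sets_bowen_ball: "0 < n \<Longrightarrow> \<omega> \<in> space P \<Longrightarrow> bowen_ball \<theta> T n \<omega> x \<epsilon> \<in> sets (\<kappa> \<omega>)"
  by (rule sets_section[OF sets_Collect_bowen_ball])

lemma sets_fk_ball:
  assumes "0 < n" "\<omega> \<in> space P"
  shows "fk_ball \<theta> T n \<omega> x \<delta> \<in> sets (\<kappa> \<omega>)"
  unfolding fk_ball_eq[OF assms(1)]
  using sets_match_ball[OF assms(2)] by (intro sets.countable_UN') (auto simp: countable_rat)


section \<open>Points of small Feldman--Katok entropy\<close>

text \<open>The exponent carries c + \<delta> rather than c: the extra \<delta> n absorbs the change
  of length from n + 1 to n under a shift.\<close>

definition good :: "real \<Rightarrow> nat \<Rightarrow> real \<Rightarrow> ('w \<times> 'x) set" where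
  "good c n \<delta> = {p\<in>space \<mu>. exp (- ((c + \<delta>) * real n)) \<le>
     measure (\<kappa> (fst p)) (match_ball \<theta> T n (fst p) (snd p) \<delta>)}"

text \<open>All tolerances are required at once, since a shift doubles the tolerance and a condition
  at a single one would degrade along the orbit.\<close>

definition low :: "real \<Rightarrow> ('w \<times> 'x) set" where
  "low c = {p\<in>space \<mu>. \<forall>k m. \<exists>n. m \<le> n \<and> p \<in> good c n (1 / real (Suc k))}"

lemma sets_good: "good c n \<delta> \<in> sets \<mu>"
  unfolding good_def using measurable_kernel_section[OF sets_Collect_match_ball, of n \<delta>]
  by measurable

lemma sets_low: "low c \<in> sets \<mu>"
proof -
  have "{p\<in>space \<mu>. p \<in> good c n \<delta>} = good c n \<delta>" for n \<delta> by (auto simp: good_def)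
  then have "{p\<in>space \<mu>. p \<in> good c n \<delta>} \<in> sets \<mu>" for n \<delta> by (simp add: sets_good)
  then show ?thesis unfolding low_def
    by (intro sets.sets_Collect_countable_All sets.sets_Collect_countable_Ex sets.sets_Collect_conj
        sets.sets_Collect_const)
qed

text \<open>The map \<open>T \<omega>\<close> sends the match ball of length n + 1 and tolerance
  \<delta> / 2 into the one of length n and tolerance \<delta> at the image point; equivariance of
  the kernel transports its mass.\<close>

lemma AE_low_skew: "AE p in \<mu>. p \<in> low c \<longrightarrow> \<Theta> p \<in> low c"
proof -
  have "AE \<omega> in distr \<mu> P fst. \<forall>C\<in>sets borel. emeasure (\<kappa> \<omega>) (T \<omega> -` C) = emeasure (\<kappa> (\<theta> \<omega>)) C"
    unfolding distr_fst by (rule AE_kernel_equivariant)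
  from AE_distrD[OF measurable_fst_\<mu> this] AE_space[of \<mu>] show ?thesis
  proof (eventually_elim, intro impI)
    fix p assume eq: "\<forall>C\<in>sets borel. emeasure (\<kappa> (fst p)) (T (fst p) -` C) = emeasure (\<kappa> (\<theta> (fst p))) C"
      and p: "p \<in> space \<mu>" and low: "p \<in> low c"
    obtain \<omega> x where px: "p = (\<omega>, x)" by (cases p)
    have \<omega>: "\<omega> \<in> space P" using p px by (simp add: space_\<mu>)
    interpret \<kappa>: prob_space "\<kappa> \<omega>" by (rule kernel(1)[OF \<omega>])
    have "\<exists>n. m \<le> n \<and> \<Theta> p \<in> good c n (1 / real (Suc k))" for k m :: nat
    proof -
      define \<delta> where "\<delta> = 1 / real (Suc k)"
      have \<delta>: "\<delta> > 0" by (simp add: \<delta>_def)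
      \<comment> \<open>In the numerator 4 + \<delta> serves the shift of matches, while \<delta> +
        2|c| serves the comparison of (c + \<delta> / 2)(n + 1) with (c + \<delta>) n.\<close>
      obtain m0 :: nat where m0: "(4 + \<delta> + 2 * \<bar>c\<bar>) / \<delta> \<le> real m0" using real_arch_simple by blast
      \<comment> \<open>Half of a tolerance of the form 1 / (k + 1) has this form again, with index
        2 k + 1.\<close>
      have half: "1 / real (Suc (2 * k + 1)) = \<delta> / 2" by (simp add: \<delta>_def field_simps)
      obtain n' where n': "Suc (max m m0) \<le> n'" "p \<in> good c n' (\<delta> / 2)"
        using low unfolding low_def half[symmetric] by blast
      then obtain n where n: "n' = Suc n" "m \<le> n" "m0 \<le> n" by (cases n') auto
      have large: "4 + \<delta> + 2 * \<bar>c\<bar> \<le> \<delta> * real n"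
      proof -
        have "(4 + \<delta> + 2 * \<bar>c\<bar>) / \<delta> \<le> real n" using m0 n(3) by linarith
        then show ?thesis using \<delta> by (simp add: field_simps)
      qed
      let ?C = "match_ball \<theta> T n (\<theta> \<omega>) (T \<omega> x) \<delta>"
      have C: "?C \<in> sets borel" using sets_match_ball[OF \<theta>_space[OF \<omega>]] kernel(2)[OF \<theta>_space[OF \<omega>]] by blast
      have "T \<omega> \<in> measurable (\<kappa> \<omega>) borel"
        using measurable_Pair2[OF measurable_T \<omega>] measurable_cong_sets[OF kernel(2)[OF \<omega>] refl] by auto
      from measurable_sets[OF this C] have TC: "T \<omega> -` ?C \<in> sets (\<kappa> \<omega>)"
        using sets_eq_imp_space_eq[OF kernel(2)[OF \<omega>]] by simp
      have "c + \<delta> / 2 \<le> \<delta> * real n / 2" using large abs_ge_self[of c] by linarith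
      then have "(c + \<delta> / 2) * real (Suc n) \<le> (c + \<delta>) * real n"
        by (simp add: algebra_simps add_divide_distrib)
      then have "exp (- ((c + \<delta>) * real n)) \<le> exp (- ((c + \<delta> / 2) * real (Suc n)))" by simp
      also have "\<dots> \<le> measure (\<kappa> \<omega>) (match_ball \<theta> T (Suc n) \<omega> x (\<delta> / 2))"
        using n'(2) by (simp add: good_def n(1) px)
      also have "\<dots> \<le> measure (\<kappa> \<omega>) (T \<omega> -` ?C)"
      proof (rule \<kappa>.finite_measure_mono[OF _ TC])
        have "4 + \<delta> \<le> \<delta> * real n" using large by linarith
        from match_ball_shift[OF _ \<delta> this]
        show "match_ball \<theta> T (Suc n) \<omega> x (\<delta> / 2) \<subseteq> T \<omega> -` ?C" by (intro subsetI vimageI2)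
      qed
      also have "\<dots> = measure (\<kappa> (\<theta> \<omega>)) ?C" using eq C by (simp add: measure_def px)
      finally have "\<Theta> p \<in> good c n \<delta>"
        using \<theta>_space[OF \<omega>] by (simp add: good_def px skew_product_def space_\<mu>)
      then show ?thesis using n(2) unfolding \<delta>_def by blast
    qed
    then show "\<Theta> p \<in> low c" using measurable_space[OF measurable_skew p] by (simp add: low_def)
  qed
qed

text \<open>The exceptional null set is pulled back by each measure-preserving iterate; countably
  many null sets arise.\<close>

lemma AE_low_orbit: "AE p in \<mu>. p \<in> low c \<longrightarrow> (\<forall>i. (\<Theta> ^^ i) p \<in> low c)"
proof -
  have "AE p in \<mu>. (\<Theta> ^^ i) p \<in> low c \<longrightarrow> \<Theta> ((\<Theta> ^^ i) p) \<in> low c" for i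
  proof (rule AE_distrD[OF measurable_funpow[OF measurable_skew]])
    show "AE p in distr \<mu> \<mu> (\<Theta> ^^ i). p \<in> low c \<longrightarrow> \<Theta> p \<in> low c"
      unfolding distr_funpow[OF measurable_skew distr_skew] by (rule AE_low_skew)
  qed
  then have "AE p in \<mu>. \<forall>i. (\<Theta> ^^ i) p \<in> low c \<longrightarrow> \<Theta> ((\<Theta> ^^ i) p) \<in> low c"
    by (simp add: AE_all_countable)
  then show ?thesis
  proof (eventually_elim, intro impI allI)
    fix p i assume "\<forall>i. (\<Theta> ^^ i) p \<in> low c \<longrightarrow> \<Theta> ((\<Theta> ^^ i) p) \<in> low c" "p \<in> low c"
    then show "(\<Theta> ^^ i) p \<in> low c" by (induction i) auto
  qed
qed

text \<open>A Vitali argument in one fibre: at most exp ((c + \<delta>) n) of the heavy balls are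
  pairwise disjoint, and by the triangle property the balls of doubled tolerance around a maximal
  such family cover.\<close>

lemma spanned_good:
  assumes \<omega>: "\<omega> \<in> space P" and k: "0 \<le> k"
    and span: "\<And>x. spanned \<theta> T \<eta> \<omega> n (match_ball \<theta> T n \<omega> x (2 * \<delta>)) k"
  shows "spanned \<theta> T \<eta> \<omega> n {x. (\<omega>, x) \<in> good c n \<delta>} (exp ((c + \<delta>) * real n) * k)"
proof -
  let ?S = "{x. (\<omega>, x) \<in> good c n \<delta>}"
  have F: "match_ball \<theta> T n \<omega> x \<delta> \<in> sets (\<kappa> \<omega>)"
    "exp (- ((c + \<delta>) * real n)) \<le> measure (\<kappa> \<omega>) (match_ball \<theta> T n \<omega> x \<delta>)" if "x \<in> ?S" for x
    using that by (simp_all add: sets_match_ball[OF \<omega>] good_def)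
  have "\<exists>E. E \<subseteq> ?S \<and> finite E \<and> real (card E) * exp (- ((c + \<delta>) * real n)) \<le> 1 \<and>
      (\<forall>x\<in>?S. \<exists>e\<in>E. match_ball \<theta> T n \<omega> e \<delta> \<inter> match_ball \<theta> T n \<omega> x \<delta> \<noteq> {})"
    by (rule prob_space.maximal_disjoint_subfamily[OF kernel(1)[OF \<omega>]]) (fact F exp_gt_zero)+
  then obtain E where E: "E \<subseteq> ?S" "finite E" "real (card E) * exp (- ((c + \<delta>) * real n)) \<le> 1"
    "\<forall>x\<in>?S. \<exists>e\<in>E. match_ball \<theta> T n \<omega> e \<delta> \<inter> match_ball \<theta> T n \<omega> x \<delta> \<noteq> {}"
    by (elim exE conjE)
  have "spanned \<theta> T \<eta> \<omega> n (\<Union>e\<in>E. match_ball \<theta> T n \<omega> e (2 * \<delta>)) (\<Sum>e\<in>E. k)"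
    by (intro spanned_UN E(2) span)
  moreover have "?S \<subseteq> (\<Union>e\<in>E. match_ball \<theta> T n \<omega> e (2 * \<delta>))"
  proof
    fix x assume "x \<in> ?S"
    then obtain e y where e: "e \<in> E" and y: "y \<in> match_ball \<theta> T n \<omega> e \<delta>" "y \<in> match_ball \<theta> T n \<omega> x \<delta>"
      using E(4) by blast
    show "x \<in> (\<Union>e\<in>E. match_ball \<theta> T n \<omega> e (2 * \<delta>))"
      using e match_ball_triangle[OF y] by (rule UN_I)
  qed
  moreover have "(\<Sum>e\<in>E. k) \<le> exp ((c + \<delta>) * real n) * k"
  proof -
    have "r * exp (- a) \<le> 1 \<Longrightarrow> r \<le> exp a" for r a :: real by (simp add: exp_minus field_simps)
    then have "real (card E) \<le> exp ((c + \<delta>) * real n)" using E(3) by blast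
    then show ?thesis using k by (simp add: mult_right_mono)
  qed
  ultimately show ?thesis by (rule spanned_mono)
qed

text \<open>Origin of 4 \<rho>: covering the good points of a fibre costs \<delta> + \<rho> \<le> 2
  \<rho>, counting tilings a third \<rho>. Half of the fourth pays for the holes; the other half
  remains as the summable factor exp (-\<rho> N / 2).\<close>

lemma AE_low_bowen_ball:
  assumes c: "c \<ge> 0" and \<eta>: "\<eta> > 0" and \<rho>: "\<rho> > 0"
  shows "AE p in \<mu>. p \<in> low c \<longrightarrow> (\<forall>\<^sub>F N in sequentially.
    exp (- ((c + 4 * \<rho>) * real N)) \<le> measure (\<kappa> (fst p)) (bowen_ball \<theta> T N (fst p) (snd p) \<eta>))"
proof -
  have "\<eta> / 2 > 0" using \<eta> by simp
  then obtain Z where Z: "finite Z" "\<And>x::'x. \<exists>z\<in>Z. dist x z < \<eta> / 2"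
    using compact_UNIV_net[OF compact_UNIV] by blast
  obtain \<epsilon>0 where \<epsilon>0: "\<epsilon>0 > 0"
    "\<And>\<omega> n x. spanned \<theta> T \<eta> \<omega> n (match_ball \<theta> T n \<omega> x \<epsilon>0) (exp (\<rho> * real n))"
    using ex_spanned_match_ball[OF Z \<rho> \<eta>] by blast
  \<comment> \<open>The tolerance \<delta> must be one of the values 1 / (k + 1) for which
    \<open>low\<close> supplies good times.\<close>
  obtain k where k: "inverse (real (Suc k)) < min (\<epsilon>0 / 2) \<rho>"
    using reals_Archimedean[of "min (\<epsilon>0 / 2) \<rho>"] \<epsilon>0(1) \<rho> by auto
  define \<delta> where "\<delta> = 1 / real (Suc k)"
  have \<delta>: "2 * \<delta> \<le> \<epsilon>0" "\<delta> \<le> \<rho>" using k by (auto simp: \<delta>_def field_simps)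
  define Q where "Q n \<omega> = {x. (\<omega>, x) \<in> good c n \<delta>}" for n \<omega>
  have Q: "spanned \<theta> T \<eta> \<omega> n (Q n \<omega>) (exp ((c + 2 * \<rho>) * real n))" if "\<omega> \<in> space P" for \<omega> n
  proof -
    have "spanned \<theta> T \<eta> \<omega> n (Q n \<omega>) (exp ((c + \<delta>) * real n) * exp (\<rho> * real n))"
      unfolding Q_def by (intro spanned_good that spanned_mono[OF \<epsilon>0(2) match_ball_mono[OF \<delta>(1)] order_refl]) simp
    then show ?thesis
    proof (rule spanned_mono)
      have "(c + \<delta>) * real n + \<rho> * real n \<le> (c + 2 * \<rho>) * real n"
        using mult_right_mono[OF \<delta>(2), of "real n"] by (simp add: algebra_simps)
      then show "exp ((c + \<delta>) * real n) * exp (\<rho> * real n) \<le> exp ((c + 2 * \<rho>) * real n)"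
        by (simp add: exp_add[symmetric])
    qed simp
  qed
  have "summable (\<lambda>n. exp (- \<rho>) ^ n)" using \<rho> by (intro summable_geometric) simp
  \<comment> \<open>Tiles are required to be at least n1 long so that the geometric tail over their
    lengths is at most 1/2.\<close>
  then obtain n1 where n1: "\<And>m n. m \<ge> n1 \<Longrightarrow> norm (\<Sum>k=m..n. exp (- \<rho>) ^ k) < 1 / 2"
    using summable_partial_sum_bound[of "\<lambda>n. exp (- \<rho>) ^ n" "1 / 2"] by auto
  define n0 where "n0 = max 1 n1"
  have n0: "1 \<le> n0" "(\<Sum>n=n0..M. exp (- ((c + 3 * \<rho>) - (c + 2 * \<rho>)) * real n)) \<le> 1 / 2" for M
  proof -
    have "(\<Sum>n=n0..M. exp (- ((c + 3 * \<rho>) - (c + 2 * \<rho>)) * real n)) = (\<Sum>n=n0..M. exp (- \<rho>) ^ n)"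
      by (intro sum.cong refl) (simp add: exp_of_nat_mult[symmetric] mult.commute)
    then show "(\<Sum>n=n0..M. exp (- ((c + 3 * \<rho>) - (c + 2 * \<rho>)) * real n)) \<le> 1 / 2"
      using n1[of n0 M] by (auto simp: n0_def)
  qed (simp add: n0_def)
  define W where "W = max 1 (2 * real (card Z))"
  have W: "1 \<le> W" "2 * real (card Z) \<le> W" by (auto simp: W_def)
  have lnW: "0 \<le> ln W" using W(1) by simp
  \<comment> \<open>The admissible frequency of holes: \<epsilon> N of them cost at most exp (\<rho>
    N / 2).\<close>
  define \<epsilon> where "\<epsilon> = \<rho> / (2 * (1 + ln W))"
  have \<epsilon>: "\<epsilon> > 0" "\<epsilon> * ln W \<le> \<rho> / 2"
  proof -
    show "\<epsilon> > 0" using \<rho> lnW by (simp add: \<epsilon>_def)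
    then have "\<epsilon> * ln W \<le> \<epsilon> * (1 + ln W)" by simp
    also have "\<dots> = \<rho> / 2" using lnW by (simp add: \<epsilon>_def field_simps)
    finally show "\<epsilon> * ln W \<le> \<rho> / 2" .
  qed
  define A where "A M = (\<Union>n\<in>{n0..M}. good c n \<delta>)" for M
  have A: "A M \<in> sets \<mu>" for M unfolding A_def by (intro sets.finite_UN sets_good) auto
  define m where "m N p = measure (\<kappa> (fst p)) (bowen_ball \<theta> T N (fst p) (snd p) \<eta>)" for N p
  \<comment> \<open>This set does not mention \<open>low\<close>: fibrewise counting covers all
    points with few holes, and membership in \<open>low\<close> is used only to bound the frequency
    of holes.\<close>
  define bad where "bad M N = {p\<in>space \<mu>. real (visits \<Theta> (space \<mu> - A M) N p) \<le> \<epsilon> * real N \<and>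
      m N p < exp (- ((c + 4 * \<rho>) * real N))}" for M N
  have bad_sets: "bad M (Suc N) \<in> sets \<mu>" for M N
  proof -
    have "m (Suc N) \<in> borel_measurable \<mu>"
      unfolding m_def by (intro measurable_kernel_section sets_Collect_bowen_ball) simp
    moreover have "(\<lambda>p. real (visits \<Theta> (space \<mu> - A M) (Suc N) p)) \<in> borel_measurable \<mu>"
      using A by (intro measurable_visits measurable_skew) auto
    ultimately show ?thesis unfolding bad_def by measurable
  qed
  have bad_section: "measure (\<kappa> \<omega>) {x. (\<omega>, x) \<in> bad M N} \<le> W ^ M * exp (- (\<rho> / 2)) ^ N"
    if \<omega>: "\<omega> \<in> space P" and N: "0 < N" for \<omega> M N
  proof -
    define h where "h = nat \<lfloor>\<epsilon> * real N\<rfloor>"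
    have "(\<theta> ^^ i) \<omega> \<in> space P" for i using \<omega> \<theta>_space by (induction i) auto
    then have visits: "visits \<Theta> (space \<mu> - A M) N (\<omega>, x) =
        card {i. i < N \<and> (\<forall>n\<in>{n0..M}. rds_iter \<theta> T i \<omega> x \<notin> Q n ((\<theta> ^^ i) \<omega>))}" for x
      unfolding visits_def by (intro arg_cong[of _ _ card]) (auto simp: skew_product_funpow space_\<mu> A_def Q_def)
    have "spanned \<theta> T \<eta> \<omega> N {x. card {i. i < N \<and> (\<forall>n\<in>{n0..M}. rds_iter \<theta> T i \<omega> x \<notin> Q n ((\<theta> ^^ i) \<omega>))} \<le> h}
        (W ^ (h + M) * exp ((c + 3 * \<rho>) * real N))"
      using c \<rho> by (intro spanned_tiling[OF Z, where \<Omega> = "space P" and b = "c + 2 * \<rho>"] \<theta>_space Q W n0 \<omega>) auto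
    moreover have "{x. (\<omega>, x) \<in> bad M N} \<subseteq>
        {x. card {i. i < N \<and> (\<forall>n\<in>{n0..M}. rds_iter \<theta> T i \<omega> x \<notin> Q n ((\<theta> ^^ i) \<omega>))} \<le> h}"
      unfolding visits[symmetric] bad_def h_def by (auto simp: le_nat_floor)
    ultimately have span: "spanned \<theta> T \<eta> \<omega> N {x. (\<omega>, x) \<in> bad M N} (W ^ (h + M) * exp ((c + 3 * \<rho>) * real N))"
      by (rule spanned_mono) simp
    have "measure (\<kappa> \<omega>) {x. (\<omega>, x) \<in> bad M N} \<le>
        W ^ (h + M) * exp ((c + 3 * \<rho>) * real N) * exp (- ((c + 4 * \<rho>) * real N))"
      by (rule measure_le_of_spanned[OF kernel(1)[OF \<omega>] span N])
        (auto simp: sets_bowen_ball[OF N \<omega>] bad_def m_def)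
    also have "\<dots> = W ^ M * (W ^ h * exp (- (\<rho> * real N)))"
      by (simp add: power_add mult_ac exp_add[symmetric] algebra_simps)
    also have "\<dots> \<le> W ^ M * (exp (\<rho> / 2 * real N) * exp (- (\<rho> * real N)))"
    proof -
      have "real h \<le> \<epsilon> * real N" using \<epsilon>(1) by (simp add: h_def)
      then have "real h * ln W \<le> \<epsilon> * real N * ln W" using lnW by (rule mult_right_mono)
      also have "\<dots> = \<epsilon> * ln W * real N" by simp
      also have "\<dots> \<le> \<rho> / 2 * real N" using \<epsilon>(2) by (rule mult_right_mono) simp
      finally have "exp (real h * ln W) \<le> exp (\<rho> / 2 * real N)" by simp
      also have "exp (real h * ln W) = W ^ h" using W(1) by (simp add: exp_of_nat_mult)
      finally show ?thesis using W(1) by (intro mult_left_mono mult_right_mono) auto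
    qed
    also have "exp (\<rho> / 2 * real N) * exp (- (\<rho> * real N)) = exp (- (\<rho> / 2)) ^ N"
      by (simp add: exp_add[symmetric] exp_of_nat_mult[symmetric] algebra_simps)
    finally show ?thesis .
  qed
  have bad: "measure \<mu> (bad M (Suc N)) \<le> W ^ M * exp (- (\<rho> / 2)) ^ Suc N" for M N
  proof -
    let ?r = "W ^ M * exp (- (\<rho> / 2)) ^ Suc N"
    have r: "0 \<le> ?r" using W(1) by simp
    have "emeasure \<mu> (bad M (Suc N)) = (\<integral>\<^sup>+\<omega>. emeasure (\<kappa> \<omega>) {x. (\<omega>, x) \<in> bad M (Suc N)} \<partial>P)"
      by (rule emeasure_\<mu>[OF bad_sets])
    also have "\<dots> \<le> (\<integral>\<^sup>+\<omega>. ennreal ?r \<partial>P)"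
    proof (rule nn_integral_mono)
      fix \<omega> assume \<omega>: "\<omega> \<in> space P"
      interpret \<kappa>: prob_space "\<kappa> \<omega>" by (rule kernel(1)[OF \<omega>])
      show "emeasure (\<kappa> \<omega>) {x. (\<omega>, x) \<in> bad M (Suc N)} \<le> ennreal ?r"
        unfolding \<kappa>.emeasure_eq_measure using bad_section[OF \<omega>, of "Suc N" M] by (intro ennreal_leI) simp
    qed
    also have "\<dots> = ennreal ?r" by (simp add: emeasure_space_1)
    finally show ?thesis using r by (simp add: \<mu>.emeasure_eq_measure)
  qed
  have "AE p in \<mu>. \<forall>\<^sub>F N in sequentially. p \<in> space \<mu> - bad M (Suc N)" for M
  proof (rule borel_cantelli_AE1[OF bad_sets])
    have "summable (\<lambda>N. W ^ M * exp (- (\<rho> / 2)) ^ Suc N)"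
      using \<rho> by (intro summable_mult summable_Suc_iff[THEN iffD2] summable_geometric) simp
    then show "summable (\<lambda>N. measure \<mu> (bad M (Suc N)))"
      by (rule summable_comparison_test_ev[rotated]) (use bad in simp)
  qed (simp add: \<mu>.emeasure_eq_measure)
  then have ev: "AE p in \<mu>. \<forall>M. \<forall>\<^sub>F N in sequentially. p \<in> space \<mu> - bad M (Suc N)"
    by (simp add: AE_all_countable)
  \<comment> \<open>Points whose hole frequency exceeds \<epsilon> at some time. A point of
    \<open>low\<close> has good times beyond n0, so \<open>low c - A M\<close> shrinks to the empty
    set and the intersection of these sets over M is null.\<close>
  define V where "V M = {p\<in>space \<mu>. \<exists>N. \<epsilon> * real N < real (visits \<Theta> (low c - A M) N p)}" for M
  have lowA: "low c - A M \<in> sets \<mu>" for M using A sets_low by blast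
  have V: "V M \<in> sets \<mu>" "measure \<mu> (V M) \<le> measure \<mu> (low c - A M) / \<epsilon>" for M
    unfolding V_def using \<mu>.maximal_ergodic_inequality[OF measurable_skew distr_skew lowA \<epsilon>(1)] by auto
  have "measure \<mu> (\<Inter>M. V M) \<le> 0"
  proof -
    have "decseq (\<lambda>M. low c - A M)" by (intro decseq_SucI) (auto simp: A_def)
    then have lim: "(\<lambda>M. measure \<mu> (low c - A M)) \<longlonglongrightarrow> measure \<mu> (\<Inter>M. low c - A M)"
      using lowA by (intro \<mu>.finite_Lim_measure_decseq) auto
    have empty: "(\<Inter>M. low c - A M) = {}"
    proof (rule equals0I)
      fix p assume p: "p \<in> (\<Inter>M. low c - A M)"
      then have "p \<in> low c" by blast
      then obtain n where "n0 \<le> n" "p \<in> good c n \<delta>" unfolding low_def \<delta>_def by blast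
      then have "p \<in> A n" by (auto simp: A_def)
      then show False using p by blast
    qed
    have "(\<lambda>M. measure \<mu> (low c - A M) / \<epsilon>) \<longlonglongrightarrow> 0 / \<epsilon>"
      using lim[unfolded empty measure_empty] \<epsilon>(1) by (intro tendsto_divide) auto
    moreover have "measure \<mu> (\<Inter>M. V M) \<le> measure \<mu> (low c - A M) / \<epsilon>" for M
      using \<mu>.finite_measure_mono[of "\<Inter>M. V M" "V M"] V by (meson INF_lower UNIV_I order_trans)
    ultimately show ?thesis by (intro LIMSEQ_le_const[of _ "0 :: real"]) auto
  qed
  then have "(\<Inter>M. V M) \<in> null_sets \<mu>"
    using V(1) by (intro null_setsI) (auto simp: \<mu>.emeasure_eq_measure measure_le_0_iff)
  from AE_not_in[OF this] ev AE_low_orbit[of c] AE_space[of \<mu>] show ?thesis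
  proof (eventually_elim, intro impI)
    fix p assume "p \<notin> (\<Inter>M. V M)" and ev: "\<forall>M. \<forall>\<^sub>F N in sequentially. p \<in> space \<mu> - bad M (Suc N)"
      and "p \<in> low c \<longrightarrow> (\<forall>i. (\<Theta> ^^ i) p \<in> low c)" and p: "p \<in> space \<mu>" and low: "p \<in> low c"
    then obtain M where M: "p \<notin> V M" and orbit: "\<And>i. (\<Theta> ^^ i) p \<in> low c" by blast
    \<comment> \<open>The whole orbit lies in \<open>low c\<close>, so its holes are exactly the
      visits controlled by the maximal inequality.\<close>
    have "visits \<Theta> (space \<mu> - A M) N p = visits \<Theta> (low c - A M) N p" for N
      unfolding visits_def using orbit by (intro arg_cong[of _ _ card]) (auto simp: low_def)
    then have few: "real (visits \<Theta> (space \<mu> - A M) N p) \<le> \<epsilon> * real N" for N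
      using M p by (auto simp: V_def not_less)
    have "\<forall>\<^sub>F N in sequentially. exp (- ((c + 4 * \<rho>) * real (Suc N))) \<le> m (Suc N) p"
      using spec[OF ev, of M] by eventually_elim (use few in \<open>auto simp: bad_def not_less simp del: of_nat_Suc\<close>)
    then show "\<forall>\<^sub>F N in sequentially.
        exp (- ((c + 4 * \<rho>) * real N)) \<le> measure (\<kappa> (fst p)) (bowen_ball \<theta> T N (fst p) (snd p) \<eta>)"
      unfolding m_def by (rule eventually_sequentially_Suc[THEN iffD1])
  qed
qed

end

section \<open>The local entropy\<close>

lemma decay_rate_antimono:
  assumes "prob_space \<nu>" "B \<subseteq> B'" "B' \<in> sets \<nu>"
  shows "decay_rate \<nu> n B' \<le> decay_rate \<nu> n B"
proof -
  interpret prob_space \<nu> by fact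
  have le: "measure \<nu> B \<le> measure \<nu> B'" by (intro finite_measure_mono assms)
  show ?thesis
  proof (cases "measure \<nu> B = 0")
    case False
    then have pos: "0 < measure \<nu> B" using measure_nonneg[of \<nu> B] by linarith
    have "ln (measure \<nu> B) \<le> ln (measure \<nu> B')" using pos le by simp
    then have "1 / real n * ln (measure \<nu> B) \<le> 1 / real n * ln (measure \<nu> B')" by (intro mult_left_mono) auto
    then show ?thesis using pos le by (simp add: decay_rate_def)
  qed (simp add: decay_rate_def)
qed

lemma decay_rate_nonneg:
  assumes "prob_space \<nu>"
  shows "0 \<le> decay_rate \<nu> n B"
proof -
  have "ln (measure \<nu> B) \<le> 0" if "measure \<nu> B \<noteq> 0"
    using that prob_space.prob_le_1[OF assms, of B] measure_nonneg[of \<nu> B] by (subst ln_le_zero_iff) linarith+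
  then show ?thesis by (simp add: decay_rate_def divide_nonpos_nonneg)
qed

lemma decay_rate_less_iff:
  assumes "0 < n"
  shows "decay_rate \<nu> n B < ereal c \<longleftrightarrow> exp (- (c * real n)) < measure \<nu> B"
proof (cases "measure \<nu> B = 0")
  case False
  then have pos: "0 < measure \<nu> B" using measure_nonneg[of \<nu> B] by linarith
  have "decay_rate \<nu> n B < ereal c \<longleftrightarrow> - (c * real n) < ln (measure \<nu> B)"
    using False assms by (simp add: decay_rate_def field_simps) argo
  also have "\<dots> \<longleftrightarrow> exp (- (c * real n)) < measure \<nu> B"
    using exp_less_cancel_iff[of "- (c * real n)" "ln (measure \<nu> B)"] pos by simp
  finally show ?thesis .
qed (simp add: decay_rate_def not_less)

lemma decay_rate_le:
  assumes "0 < n" "exp (- (c * real n)) \<le> measure \<nu> B"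
  shows "decay_rate \<nu> n B \<le> ereal c"
proof -
  have pos: "0 < measure \<nu> B" using assms(2) exp_gt_zero less_le_trans by blast
  have "- (c * real n) \<le> ln (measure \<nu> B)" using assms(2) pos by (simp add: ln_ge_iff)
  then show ?thesis using assms(1) pos by (simp add: decay_rate_def field_simps)
qed

context disintegrated_rds
begin

text \<open>If the inequality fails, a rational c separates the two sides. Then p belongs to
  \<open>low c\<close>, and Bowen balls decay at rate at most c + 4 / (l + 1) for every l, a
  contradiction. Rational c and reciprocal integers keep the exceptional set null.\<close>

lemma AE_bowen_le_fk:
  "AE p in \<mu>. (SUP \<delta>\<in>{0<..}. limsup (\<lambda>n. decay_rate (\<kappa> (fst p)) n (bowen_ball \<theta> T n (fst p) (snd p) \<delta>)))
    \<le> (SUP \<delta>\<in>{0<..}. liminf (\<lambda>n. decay_rate (\<kappa> (fst p)) n (fk_ball \<theta> T n (fst p) (snd p) \<delta>)))"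
proof -
  define m where "m N p \<eta> = measure (\<kappa> (fst p)) (bowen_ball \<theta> T N (fst p) (snd p) \<eta>)" for N p \<eta>
  let ?inv = "\<lambda>j. 1 / real (Suc j)"
  have "AE p in \<mu>. p \<in> low (max 0 (of_rat c)) \<longrightarrow>
      (\<forall>\<^sub>F N in sequentially. exp (- ((max 0 (of_rat c) + 4 * ?inv l) * real N)) \<le> m N p (?inv j))" for c j l
    unfolding m_def by (intro AE_low_bowen_ball) auto
  then have "AE p in \<mu>. \<forall>c j l. p \<in> low (max 0 (of_rat c)) \<longrightarrow>
      (\<forall>\<^sub>F N in sequentially. exp (- ((max 0 (of_rat c) + 4 * ?inv l) * real N)) \<le> m N p (?inv j))"
    by (simp only: AE_all_countable simp_thms)
  with AE_space[of \<mu>] show ?thesis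
  proof eventually_elim
    case (elim p)
    obtain \<omega> x where p: "p = (\<omega>, x)" by (cases p)
    have \<omega>: "\<omega> \<in> space P" using elim(1) p by (simp add: space_\<mu>)
    interpret \<kappa>: prob_space "\<kappa> \<omega>" by (rule kernel(1)[OF \<omega>])
    define U where "U \<delta> = limsup (\<lambda>n. decay_rate (\<kappa> \<omega>) n (bowen_ball \<theta> T n \<omega> x \<delta>))" for \<delta>
    define L where "L \<delta> = liminf (\<lambda>n. decay_rate (\<kappa> \<omega>) n (fk_ball \<theta> T n \<omega> x \<delta>))" for \<delta>
    have "(SUP \<delta>\<in>{0<..}. U \<delta>) \<le> (SUP \<delta>\<in>{0<..}. L \<delta>)"
    proof (rule ccontr)
      assume "\<not> (SUP \<delta>\<in>{0<..}. U \<delta>) \<le> (SUP \<delta>\<in>{0<..}. L \<delta>)"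
      then obtain c where c: "(SUP \<delta>\<in>{0<..}. L \<delta>) < ereal (of_rat c)" "ereal (of_rat c) < (SUP \<delta>\<in>{0<..}. U \<delta>)"
        using ereal_dense3[of "SUP \<delta>\<in>{0<..}. L \<delta>" "SUP \<delta>\<in>{0<..}. U \<delta>"] by (auto simp: not_le)
      let ?c = "of_rat c :: real"
      have L: "L \<delta> < ereal ?c" if "\<delta> > 0" for \<delta>
        using c(1) that by (auto intro: le_less_trans[OF SUP_upper])
      \<comment> \<open>Rates are nonnegative, so c is positive and the truncation at 0, inserted to
        have a nonnegative constant for every rational, disappears.\<close>
      have L1: "0 \<le> L 1" unfolding L_def
        by (intro Liminf_bounded always_eventually allI decay_rate_nonneg \<kappa>.prob_space_axioms)
      have "0 < ereal ?c" using le_less_trans[OF L1 L[of 1]] by simp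
      then have c0: "max 0 ?c = ?c" by simp
      have "\<exists>n. k' \<le> n \<and> p \<in> good ?c n (?inv k)" for k k'
      proof -
        have "\<not> (\<forall>\<^sub>F n in sequentially. ereal ?c \<le> decay_rate (\<kappa> \<omega>) n (fk_ball \<theta> T n \<omega> x (?inv k)))"
        proof
          assume "\<forall>\<^sub>F n in sequentially. ereal ?c \<le> decay_rate (\<kappa> \<omega>) n (fk_ball \<theta> T n \<omega> x (?inv k))"
          then have "ereal ?c \<le> L (?inv k)" unfolding L_def by (rule Liminf_bounded)
          then show False using L[of "?inv k"] by simp
        qed
        then obtain n where n: "max 1 k' \<le> n" "decay_rate (\<kappa> \<omega>) n (fk_ball \<theta> T n \<omega> x (?inv k)) < ereal ?c"
          unfolding eventually_sequentially by (metis not_le)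
        then have n0: "0 < n" by simp
        have "exp (- ((?c + ?inv k) * real n)) \<le> exp (- (?c * real n))"
          by (simp add: algebra_simps)
        also have "\<dots> < measure (\<kappa> \<omega>) (fk_ball \<theta> T n \<omega> x (?inv k))"
          using n(2) by (simp only: decay_rate_less_iff[OF n0])
        also have "\<dots> \<le> measure (\<kappa> \<omega>) (match_ball \<theta> T n \<omega> x (?inv k))"
          by (intro \<kappa>.finite_measure_mono fk_ball_subset_match_ball n0 sets_match_ball \<omega>)
        finally have "p \<in> good ?c n (?inv k)" using elim(1) by (simp add: good_def p)
        then show ?thesis using n(1) by auto
      qed
      then have "p \<in> low ?c" using elim(1) by (simp add: low_def)
      then have ev: "\<forall>\<^sub>F N in sequentially. exp (- ((?c + 4 * ?inv l) * real N)) \<le> m N p (?inv j)" for j l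
        using elim(2) c0 by metis
      have "U \<delta> \<le> ereal ?c" if \<delta>: "\<delta> > 0" for \<delta>
      proof -
        obtain j where j: "inverse (real (Suc j)) < \<delta>" using reals_Archimedean[OF \<delta>] by blast
        have bound: "U \<delta> \<le> ereal (?c + 4 * ?inv l)" for l
          unfolding U_def
        proof (rule Limsup_bounded)
          show "\<forall>\<^sub>F N in sequentially. decay_rate (\<kappa> \<omega>) N (bowen_ball \<theta> T N \<omega> x \<delta>) \<le> ereal (?c + 4 * ?inv l)"
            using ev[of l j] eventually_gt_at_top[of 0]
          proof eventually_elim
            case (elim N)
            have "decay_rate (\<kappa> \<omega>) N (bowen_ball \<theta> T N \<omega> x \<delta>) \<le> decay_rate (\<kappa> \<omega>) N (bowen_ball \<theta> T N \<omega> x (?inv j))"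
              using j elim(2)
              by (intro decay_rate_antimono \<kappa>.prob_space_axioms bowen_ball_mono sets_bowen_ball \<omega>)
                (auto simp: inverse_eq_divide)
            also have "\<dots> \<le> ereal (?c + 4 * ?inv l)" using elim by (intro decay_rate_le) (auto simp: m_def p)
            finally show ?case .
          qed
        qed
        have "(\<lambda>l. ereal (?c + 4 * ?inv l)) \<longlonglongrightarrow> ereal (?c + 4 * 0)"
          by (intro tendsto_intros LIMSEQ_Suc lim_const_over_n)
        then have "U \<delta> \<le> ereal (?c + 4 * 0)"
          by (rule LIMSEQ_le_const) (use bound in blast)
        then show ?thesis by simp
      qed
      then have "(SUP \<delta>\<in>{0<..}. U \<delta>) \<le> ereal ?c" by (intro SUP_least) auto
      then show False using c(2) by simp
    qed
    then show ?case by (simp add: U_def L_def p)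
  qed
qed

text \<open>In the limit of small radii, FK liminf \<le> Bowen liminf \<le> Bowen limsup \<le> FK
  liminf, and the FK limsup lies between the FK liminf and the Bowen limsup. All four coincide, and
  h is their common value.\<close>

lemma AE_local_entropy:
  "AE (\<omega>, x) in \<mu>. \<exists>h. has_local_entropy \<theta> T \<kappa> \<omega> x h \<and>
    ((\<lambda>\<delta>. liminf (\<lambda>n. decay_rate (\<kappa> \<omega>) n (fk_ball \<theta> T n \<omega> x \<delta>))) \<longlongrightarrow> h) (at_right 0) \<and>
    ((\<lambda>\<delta>. limsup (\<lambda>n. decay_rate (\<kappa> \<omega>) n (fk_ball \<theta> T n \<omega> x \<delta>))) \<longlongrightarrow> h) (at_right 0)"
  using AE_bowen_le_fk AE_space[of \<mu>]
proof eventually_elim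
  case (elim p)
  obtain \<omega> x where p: "p = (\<omega>, x)" by (cases p)
  have \<omega>: "\<omega> \<in> space P" using elim(2) p by (simp add: space_\<mu>)
  note prob = kernel(1)[OF \<omega>]
  define b where "b = (\<lambda>\<delta> n. decay_rate (\<kappa> \<omega>) n (bowen_ball \<theta> T n \<omega> x \<delta>))"
  define f where "f = (\<lambda>\<delta> n. decay_rate (\<kappa> \<omega>) n (fk_ball \<theta> T n \<omega> x \<delta>))"
  \<comment> \<open>The comparisons need n > 0 only, so they hold eventually, which is enough for
    liminf and limsup.\<close>
  have b: "\<forall>\<^sub>F n in sequentially. b \<delta>' n \<le> b \<delta> n" if "\<delta> \<le> \<delta>'" for \<delta> \<delta>'
    using eventually_gt_at_top[of 0]
    by eventually_elim (unfold b_def, intro decay_rate_antimono prob bowen_ball_mono sets_bowen_ball \<omega> that)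
  have f: "\<forall>\<^sub>F n in sequentially. f \<delta>' n \<le> f \<delta> n" if "\<delta> \<le> \<delta>'" for \<delta> \<delta>'
    using eventually_gt_at_top[of 0]
    by eventually_elim (unfold f_def, intro decay_rate_antimono prob fk_ball_mono sets_fk_ball \<omega> that)
  have fb: "\<forall>\<^sub>F n in sequentially. f \<delta> n \<le> b \<delta> n" if "\<delta> > 0" for \<delta>
    using eventually_gt_at_top[of 0]
    by eventually_elim (unfold f_def b_def, intro decay_rate_antimono prob bowen_ball_subset_fk_ball sets_fk_ball \<omega> that)
  let ?S = "\<lambda>g. SUP \<delta>\<in>{0<..}. g \<delta> :: ereal"
  let ?lb = "\<lambda>\<delta>. liminf (b \<delta>)" and ?ub = "\<lambda>\<delta>. limsup (b \<delta>)"
  let ?lf = "\<lambda>\<delta>. liminf (f \<delta>)" and ?uf = "\<lambda>\<delta>. limsup (f \<delta>)"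
  have "?S ?ub \<le> ?S ?lf" using elim(1) by (simp add: p b_def f_def)
  moreover have "?S ?lf \<le> ?S ?lb" "?S ?uf \<le> ?S ?ub"
    by (intro SUP_subset_mono order_refl Liminf_mono Limsup_mono fb; simp)+
  moreover have "?S ?lf \<le> ?S ?uf" "?S ?lb \<le> ?S ?ub"
    by (intro SUP_subset_mono order_refl Liminf_le_Limsup; simp)+
  ultimately have eq: "?S ?lb = ?S ?ub" "?S ?lf = ?S ?ub" "?S ?uf = ?S ?ub"
    by (meson order_trans order_antisym)+
  have "(?lb \<longlongrightarrow> ?S ?lb) (at_right 0)" "(?ub \<longlongrightarrow> ?S ?ub) (at_right 0)"
    "(?lf \<longlongrightarrow> ?S ?lf) (at_right 0)" "(?uf \<longlongrightarrow> ?S ?uf) (at_right 0)"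
    by (intro tendsto_SUP_at_right_0 Liminf_mono Limsup_mono b f; assumption)+
  note this[unfolded eq]
  then show ?case unfolding p has_local_entropy_def b_def f_def by auto
qed

end

theorem theorem1p2:
  fixes P :: "'w measure" and \<theta> :: "'w \<Rightarrow> 'w"
    and T :: "'w \<Rightarrow> 'x \<Rightarrow> 'x :: metric_space"
    and \<mu> :: "('w \<times> 'x) measure" and \<kappa> :: "'w \<Rightarrow> 'x measure"
  assumes "compact (UNIV :: 'x set)"
    and "continuous_bundle_rds P \<theta> T"
    and "\<mu> \<in> invariant_measures P \<theta> T"
    and "is_disintegration P \<mu> \<kappa>"
  shows "AE (\<omega>, x) in \<mu>. \<exists>h.
    has_local_entropy \<theta> T \<kappa> \<omega> x h \<and>
    ((\<lambda>\<delta>. liminf (\<lambda>n. decay_rate (\<kappa> \<omega>) n (fk_ball \<theta> T n \<omega> x \<delta>))) \<longlongrightarrow> h) (at_right 0) \<and>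
    ((\<lambda>\<delta>. limsup (\<lambda>n. decay_rate (\<kappa> \<omega>) n (fk_ball \<theta> T n \<omega> x \<delta>))) \<longlongrightarrow> h) (at_right 0)"
proof -
  interpret disintegrated_rds P \<theta> T \<mu> \<kappa>
    using assms by (intro disintegrated_rds.intro disintegrated_rds_axioms.intro)
  show ?thesis by (rule AE_local_entropy)
qed

end
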